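(* Let $Q$ be an $n$-dimensional smooth manifold, let $\Gamma$ be a SODE vector field on $TQ$ with local expression $$\Gamma=\sum_{i=1}^n\left(v^i\frac{\partial}{\partial x^i}+X^i(x,v)\frac{\partial}{\partial v^i}\right)$$ in natural tangent bundle coordinates $(x^i,v^i)$, and let $f\in C^\infty(Q)$ be a nowhere-vanishing function of constant sign (also denoting by $f$ its pull-back to $TQ$). Consider the Sundman transformation $dt=f\,d\tau$, and set $\bar\Gamma=f\,\Gamma$. Then: (1) If $c(t)$ is an integral curve of $\Gamma$ projecting onto the curve $x(t)$ in $Q$, and $\tau(t)$ satisfies $d\tau/dt=1/f(x(t))$, then the curve $\bar c(\tau)$ defined by $\bar c(\tau(t))=c(t)$ is an integral curve of $\bar\Gamma$. (2) In the local coordinates $(\bar x^i,\bar v^i)$ on $TQ$ given by $\bar x^i=x^i$, $\bar v^i=f\,v^i$, one has $$\bar\Gamma=\sum_{j=1}^n\bar v^j\frac{\partial}{\partial\bar x^j}+\sum_{i=1}^n\left(\sum_{j=1}^n\frac1f\frac{\partial f}{\partial\bar x^j}\bar v^j\,\bar v^i+f^2X^i\left(\bar x,\frac{\bar v}{f}\right)\right)\frac{\partial}{\partial\bar v^i},$$ so the projections onto $Q$ of the integral curves of $\bar\Gamma$ are solutions of $$\frac{d^2\bar x^i}{d\tau^2}=\left(\sum_{j=1}^n\frac1f\frac{\partial f}{\partial\bar x^j}\frac{d\bar x^j}{d\tau}\right)\frac{d\bar x^i}{d\tau}+f^2X^i\left(\bar x,\frac1f\frac{d\bar x}{d\tau}\right),\qquad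 i=1,\dots,n.$$ (3) Unless $f\equiv 1$, the vector field $\bar\Gamma$ is not a SODE vector field with respect to the natural tangent structure $S$ of $TQ$. However, $\bar S=f^{-1}S$ is an integrable almost tangent structure on $TQ$, with local expression $\bar S=\sum_{i}\frac{\partial}{\partial\bar v^i}\otimes d\bar x^i$ and Liouville vector field $\bar\Delta=\sum_i\bar v^i\frac{\partial}{\partial\bar v^i}=\Delta$, and $\bar\Gamma$ is a SODE vector field with respect to $\bar S$, i.e. $\bar S(\bar\Gamma)=\bar\Delta$.
   Context: Natural coordinates $(x^i,v^i)$ on $TQ$ are those induced by coordinates $(x^i)$ on $Q$. The Liouville vector field of $TQ$ is $\Delta=\sum_i v^i\,\partial/\partial v^i$, and the vertical endomorphism (natural tangent structure) is the $(1,1)$-tensor field $S=\sum_i\frac{\partial}{\partial v^i}\otimes dx^i$. A SODE vector field on $TQ$ (with respect to $S$) is a vector field $\Gamma$ with $S(\Gamma)=\Delta$. An almost tangent structure on a manifold $M$ is a $(1,1)$-tensor field $S$ with $\ker S_p=\operatorname{Im}S_p$ at every $p\in M$; it is integrable if its Nijenhuis tensor $N_S(X_1,X_2)=[S(X_1),S(X_2)]-S([S(X_1),X_2])-S([X_1,S(X_2)])$ vanishes. If such a structure is locally $\sum_i\frac{\partial}{\partial u^i}\otimes dx^i$, with the coordinates $u^i$ vanishing on the chosen zero section (here the usual zero section of $TQ$), its Liouville vector field is $\sum_i u^i\,\partial/\partial u^i$, and a vector field is called SODE with respect to it if the tensor field maps it to this Liouville vector field. *)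

theory Defs
  imports "HOL-Analysis.Analysis"
begin

section \<open>Smooth maps between Euclidean spaces\<close>

text \<open>Only meant for open sets \<open>S\<close>.\<close>

fun C_diff_on :: "nat \<Rightarrow> 'a::euclidean_space set \<Rightarrow> ('a \<Rightarrow> 'b::real_normed_vector) \<Rightarrow> bool" where
  "C_diff_on 0 S f \<longleftrightarrow> continuous_on S f"
| "C_diff_on (Suc k) S f \<longleftrightarrow>
     (\<forall>x\<in>S. f differentiable (at x)) \<and>
     (\<forall>h. C_diff_on k S (\<lambda>x. frechet_derivative f (at x) h))"

definition smooth_on :: "'a::euclidean_space set \<Rightarrow> ('a \<Rightarrow> 'b::real_normed_vector) \<Rightarrow> bool" where
  "smooth_on S f \<longleftrightarrow> (\<forall>k. C_diff_on k S f)"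


section \<open>Manifolds given by an atlas\<close>

text \<open>A chart is a pair of a domain and a coordinate map; the values of the coordinate map outside
  the domain are irrelevant. A manifold is represented by an atlas, which determines the carrier,
  the topology and the maximal atlas \<open>charts A\<close>.\<close>

type_synonym ('m, 'e) chart = "'m set \<times> ('m \<Rightarrow> 'e)"

definition carrier :: "('m, 'e) chart set \<Rightarrow> 'm set" where
  "carrier A = (\<Union>c\<in>A. fst c)"

definition transition :: "('m, 'e) chart \<Rightarrow> ('m, 'f) chart \<Rightarrow> 'e \<Rightarrow> 'f" where
  "transition c d = snd d \<circ> inv_into (fst c) (snd c)"

definition is_chart :: "('m, 'e::euclidean_space) chart \<Rightarrow> bool" where
  "is_chart c \<longleftrightarrow> inj_on (snd c) (fst c) \<and> open (snd c ` fst c)"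

definition compatible :: "('m, 'e::euclidean_space) chart \<Rightarrow> ('m, 'e) chart \<Rightarrow> bool" where
  "compatible c d \<longleftrightarrow>
     open (snd c ` (fst c \<inter> fst d)) \<and> open (snd d ` (fst c \<inter> fst d)) \<and>
     smooth_on (snd c ` (fst c \<inter> fst d)) (transition c d) \<and>
     smooth_on (snd d ` (fst c \<inter> fst d)) (transition d c)"

definition smooth_atlas :: "('m, 'e::euclidean_space) chart set \<Rightarrow> bool" where
  "smooth_atlas A \<longleftrightarrow> (\<forall>c\<in>A. is_chart c) \<and> (\<forall>c\<in>A. \<forall>d\<in>A. compatible c d)"

definition charts :: "('m, 'e::euclidean_space) chart set \<Rightarrow> ('m, 'e) chart set" where
  "charts A = {c. is_chart c \<and> fst c \<subseteq> carrier A \<and> (\<forall>d\<in>A. compatible c d)}"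

definition manifold_topology :: "('m, 'e::euclidean_space) chart set \<Rightarrow> 'm topology" where
  "manifold_topology A =
     topology (\<lambda>U. U \<subseteq> carrier A \<and> (\<forall>c\<in>A. open (snd c ` (U \<inter> fst c))))"

lemma openin_manifold_topology:
  assumes "smooth_atlas A"
  shows "openin (manifold_topology A) U \<longleftrightarrow>
           U \<subseteq> carrier A \<and> (\<forall>c\<in>A. open (snd c ` (U \<inter> fst c)))"
proof -
  let ?P = "\<lambda>U. U \<subseteq> carrier A \<and> (\<forall>c\<in>A. open (snd c ` (U \<inter> fst c)))"
  have "istopology ?P"
    unfolding istopology_def
  proof (intro conjI allI impI)
    fix S T assume S: "?P S" and T: "?P T"
    have "snd c ` (S \<inter> T \<inter> fst c) = snd c ` (S \<inter> fst c) \<inter> snd c ` (T \<inter> fst c)" if "c \<in> A" for c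
    proof -
      have "inj_on (snd c) (fst c)"
        using assms that by (auto simp: smooth_atlas_def is_chart_def)
      then show ?thesis
        by (auto dest: inj_onD)
    qed
    then show "S \<inter> T \<subseteq> carrier A" "\<forall>c\<in>A. open (snd c ` (S \<inter> T \<inter> fst c))"
      using S T by auto
  next
    fix \<K> assume \<K>: "\<forall>K\<in>\<K>. ?P K"
    show "\<Union>\<K> \<subseteq> carrier A"
      using \<K> by blast
    show "\<forall>c\<in>A. open (snd c ` (\<Union>\<K> \<inter> fst c))"
    proof
      fix c assume "c \<in> A"
      have "snd c ` (\<Union>\<K> \<inter> fst c) = (\<Union>K\<in>\<K>. snd c ` (K \<inter> fst c))"
        by blast
      moreover have "open (\<Union>K\<in>\<K>. snd c ` (K \<inter> fst c))"
        using \<K> \<open>c \<in> A\<close> by (intro open_UN) blast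
      ultimately show "open (snd c ` (\<Union>\<K> \<inter> fst c))"
        by simp
    qed
  qed
  then show ?thesis
    by (simp add: manifold_topology_def)
qed

definition smooth_manifold :: "('m, 'e::euclidean_space) chart set \<Rightarrow> bool" where
  "smooth_manifold A \<longleftrightarrow> smooth_atlas A \<and>
     Hausdorff_space (manifold_topology A) \<and> second_countable (manifold_topology A)"

definition smooth_function :: "('m, 'e::euclidean_space) chart set \<Rightarrow> ('m \<Rightarrow> real) \<Rightarrow> bool" where
  "smooth_function A g \<longleftrightarrow>
     (\<forall>c\<in>charts A. smooth_on (snd c ` fst c) (g \<circ> inv_into (fst c) (snd c)))"

text \<open>Derivative of \<open>g\<close> at \<open>p\<close> along the vector \<open>b\<close> of the coordinate space of \<open>c\<close>.\<close>

definition coord_deriv :: "('m, 'e::euclidean_space) chart \<Rightarrow> 'e \<Rightarrow> ('m \<Rightarrow> real) \<Rightarrow> 'm \<Rightarrow> real" where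
  "coord_deriv c b g p = frechet_derivative (g \<circ> inv_into (fst c) (snd c)) (at (snd c p)) b"


section \<open>Tangent vectors\<close>

text \<open>A tangent vector at \<open>p\<close> is a family of components, one for each chart of the maximal atlas
  around \<open>p\<close>, which transform by the derivatives of the transition maps. The components at all
  other pairs \<open>(U, \<phi>)\<close> are set to zero, so that equal vectors are equal as families.\<close>

datatype ('m, 'e) tvec = TVec (comps: "('m, 'e) chart \<Rightarrow> 'e")

instantiation tvec :: (type, real_vector) real_vector
begin
definition "0 = TVec (\<lambda>_. 0)"
definition "v + w = TVec (\<lambda>c. comps v c + comps w c)"
definition "v - w = TVec (\<lambda>c. comps v c - comps w c)"
definition "- v = TVec (\<lambda>c. - comps v c)"
definition "r *\<^sub>R v = TVec (\<lambda>c. r *\<^sub>R comps v c)"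
instance
  by standard
    (auto simp: zero_tvec_def plus_tvec_def minus_tvec_def uminus_tvec_def scaleR_tvec_def
      algebra_simps intro!: tvec.expand)
end

definition tangent_space :: "('m, 'e::euclidean_space) chart set \<Rightarrow> 'm \<Rightarrow> ('m, 'e) tvec set" where
  "tangent_space A p = {v.
     (\<forall>c\<in>charts A. \<forall>d\<in>charts A. p \<in> fst c \<inter> fst d \<longrightarrow>
        comps v d = frechet_derivative (transition c d) (at (snd c p)) (comps v c)) \<and>
     (\<forall>c. \<not> (c \<in> charts A \<and> p \<in> fst c) \<longrightarrow> comps v c = 0)}"

text \<open>The tangent vector at \<open>p\<close> whose components in the chart \<open>d\<close> are \<open>b\<close>; for a standard basis
  vector \<open>b\<close> this is the coordinate vector field of \<open>d\<close>.\<close>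

definition coord_vec ::
  "('m, 'e::euclidean_space) chart set \<Rightarrow> ('m, 'e) chart \<Rightarrow> 'e \<Rightarrow> 'm \<Rightarrow> ('m, 'e) tvec" where
  "coord_vec A d b p = TVec (\<lambda>c. if c \<in> charts A \<and> p \<in> fst c
     then frechet_derivative (transition d c) (at (snd d p)) b else 0)"


section \<open>Vector fields, tensor fields and integral curves\<close>

definition vector_field ::
  "('m, 'e::euclidean_space) chart set \<Rightarrow> ('m \<Rightarrow> ('m, 'e) tvec) \<Rightarrow> bool" where
  "vector_field A X \<longleftrightarrow>
     (\<forall>p\<in>carrier A. X p \<in> tangent_space A p) \<and>
     (\<forall>c\<in>charts A. smooth_on (snd c ` fst c) (\<lambda>z. comps (X (inv_into (fst c) (snd c) z)) c))"

text \<open>(1,1)-tensor fields, as fields of endomorphisms of the tangent spaces.\<close>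

definition tensor_field ::
  "('m, 'e::euclidean_space) chart set \<Rightarrow> ('m \<Rightarrow> ('m, 'e) tvec \<Rightarrow> ('m, 'e) tvec) \<Rightarrow> bool" where
  "tensor_field A T \<longleftrightarrow>
     (\<forall>p\<in>carrier A. \<forall>v\<in>tangent_space A p. T p v \<in> tangent_space A p \<and>
        (\<forall>w\<in>tangent_space A p. T p (v + w) = T p v + T p w) \<and>
        (\<forall>r. T p (r *\<^sub>R v) = r *\<^sub>R T p v)) \<and>
     (\<forall>c\<in>charts A. \<forall>b. smooth_on (snd c ` fst c)
        (\<lambda>z. let p = inv_into (fst c) (snd c) z in comps (T p (coord_vec A c b p)) c))"

definition lie_bracket ::
  "('m, 'e::euclidean_space) chart set \<Rightarrow> ('m \<Rightarrow> ('m, 'e) tvec) \<Rightarrow> ('m \<Rightarrow> ('m, 'e) tvec) \<Rightarrow>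
     'm \<Rightarrow> ('m, 'e) tvec" where
  "lie_bracket A X Y p = TVec (\<lambda>c. if c \<in> charts A \<and> p \<in> fst c
     then let rep = (\<lambda>Z z. comps (Z (inv_into (fst c) (snd c) z)) c) in
       frechet_derivative (rep Y) (at (snd c p)) (comps (X p) c) -
       frechet_derivative (rep X) (at (snd c p)) (comps (Y p) c)
     else 0)"

definition nijenhuis ::
  "('m, 'e::euclidean_space) chart set \<Rightarrow> ('m \<Rightarrow> ('m, 'e) tvec \<Rightarrow> ('m, 'e) tvec) \<Rightarrow>
     ('m \<Rightarrow> ('m, 'e) tvec) \<Rightarrow> ('m \<Rightarrow> ('m, 'e) tvec) \<Rightarrow> 'm \<Rightarrow> ('m, 'e) tvec" where
  "nijenhuis A S X Y p =
     lie_bracket A (\<lambda>p. S p (X p)) (\<lambda>p. S p (Y p)) p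
     - S p (lie_bracket A (\<lambda>p. S p (X p)) Y p)
     - S p (lie_bracket A X (\<lambda>p. S p (Y p)) p)"

definition almost_tangent_structure ::
  "('m, 'e::euclidean_space) chart set \<Rightarrow> ('m \<Rightarrow> ('m, 'e) tvec \<Rightarrow> ('m, 'e) tvec) \<Rightarrow> bool" where
  "almost_tangent_structure A S \<longleftrightarrow> tensor_field A S \<and>
     (\<forall>p\<in>carrier A. {v \<in> tangent_space A p. S p v = 0} = S p ` tangent_space A p)"

definition integrable_structure ::
  "('m, 'e::euclidean_space) chart set \<Rightarrow> ('m \<Rightarrow> ('m, 'e) tvec \<Rightarrow> ('m, 'e) tvec) \<Rightarrow> bool" where
  "integrable_structure A S \<longleftrightarrow>
     (\<forall>X Y. vector_field A X \<and> vector_field A Y \<longrightarrow> (\<forall>p\<in>carrier A. nijenhuis A S X Y p = 0))"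

definition has_velocity ::
  "('m, 'e::euclidean_space) chart set \<Rightarrow> (real \<Rightarrow> 'm) \<Rightarrow> ('m, 'e) tvec \<Rightarrow> real \<Rightarrow> bool" where
  "has_velocity A \<gamma> v t \<longleftrightarrow> (\<forall>c\<in>charts A. \<gamma> t \<in> fst c \<longrightarrow>
     (\<forall>\<^sub>F s in nhds t. \<gamma> s \<in> fst c) \<and> ((snd c \<circ> \<gamma>) has_vector_derivative comps v c) (at t))"

definition integral_curve ::
  "('m, 'e::euclidean_space) chart set \<Rightarrow> ('m \<Rightarrow> ('m, 'e) tvec) \<Rightarrow> real set \<Rightarrow> (real \<Rightarrow> 'm) \<Rightarrow>
     bool" where
  "integral_curve A X I \<gamma> \<longleftrightarrow> open I \<and> is_interval I \<and>
     (\<forall>t\<in>I. \<gamma> t \<in> carrier A \<and> has_velocity A \<gamma> (X (\<gamma> t)) t)"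


section \<open>The tangent bundle\<close>

type_synonym ('q, 'n) tb = "'q \<times> ('q, real^'n) tvec"
type_synonym ('q, 'n) tb_chart = "(('q, 'n) tb, (real^'n) \<times> (real^'n)) chart"
type_synonym ('q, 'n) tb_tvec = "(('q, 'n) tb, (real^'n) \<times> (real^'n)) tvec"

text \<open>The chart \<open>(q, w) \<mapsto> (x, g v)\<close> over the domain of the chart \<open>c\<close> of the base, with
  \<open>(x, v)\<close> the natural coordinates.\<close>

definition scaled_chart ::
  "('q, real^'n::finite) chart set \<Rightarrow> ('q \<Rightarrow> real) \<Rightarrow> ('q, real^'n) chart \<Rightarrow> ('q, 'n) tb_chart" where
  "scaled_chart Q g c =
     ({(q, w). q \<in> fst c \<and> w \<in> tangent_space Q q}, \<lambda>(q, w). (snd c q, g q *\<^sub>R comps w c))"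

abbreviation natural_chart ::
  "('q, real^'n::finite) chart set \<Rightarrow> ('q, real^'n) chart \<Rightarrow> ('q, 'n) tb_chart" where
  "natural_chart Q \<equiv> scaled_chart Q (\<lambda>_. 1)"

definition tangent_bundle :: "('q, real^'n::finite) chart set \<Rightarrow> ('q, 'n) tb_chart set" where
  "tangent_bundle Q = natural_chart Q ` charts Q"

text \<open>Coordinate vector fields of a chart \<open>d\<close> of the tangent bundle with coordinates
  \<open>(x, u)\<close>, along the \<open>i\<close>-th coordinate of the first and of the second block.\<close>

definition ddx ::
  "('q, real^'n::finite) chart set \<Rightarrow> ('q, 'n) tb_chart \<Rightarrow> 'n \<Rightarrow> ('q, 'n) tb \<Rightarrow> ('q, 'n) tb_tvec" where
  "ddx Q d i = coord_vec (tangent_bundle Q) d (axis i 1, 0)"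

definition ddu ::
  "('q, real^'n::finite) chart set \<Rightarrow> ('q, 'n) tb_chart \<Rightarrow> 'n \<Rightarrow> ('q, 'n) tb \<Rightarrow> ('q, 'n) tb_tvec" where
  "ddu Q d i = coord_vec (tangent_bundle Q) d (0, axis i 1)"

text \<open>\<open>\<Sum>\<^sub>i \<partial>/\<partial>u\<^sup>i \<otimes> dx\<^sup>i\<close> and \<open>\<Sum>\<^sub>i u\<^sup>i \<partial>/\<partial>u\<^sup>i\<close> in the chart \<open>d\<close>.\<close>

definition chart_tensor ::
  "('q, real^'n::finite) chart set \<Rightarrow> ('q, 'n) tb_chart \<Rightarrow>
     ('q, 'n) tb \<Rightarrow> ('q, 'n) tb_tvec \<Rightarrow> ('q, 'n) tb_tvec" where
  "chart_tensor Q d y w = (\<Sum>i\<in>UNIV. (fst (comps w d) $ i) *\<^sub>R ddu Q d i y)"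

definition chart_liouville ::
  "('q, real^'n::finite) chart set \<Rightarrow> ('q, 'n) tb_chart \<Rightarrow> ('q, 'n) tb \<Rightarrow> ('q, 'n) tb_tvec" where
  "chart_liouville Q d y = (\<Sum>i\<in>UNIV. (snd (snd d y) $ i) *\<^sub>R ddu Q d i y)"

text \<open>The natural tangent structure and the Liouville vector field of the tangent bundle are given
  by these expressions in natural coordinates. They do not depend on the natural chart, so at each
  point one is chosen.\<close>

definition natural_chart_at ::
  "('q, real^'n::finite) chart set \<Rightarrow> ('q, 'n) tb \<Rightarrow> ('q, 'n) tb_chart" where
  "natural_chart_at Q y = natural_chart Q (SOME c. c \<in> charts Q \<and> fst y \<in> fst c)"

definition natural_structure ::
  "('q, real^'n::finite) chart set \<Rightarrow> ('q, 'n) tb \<Rightarrow> ('q, 'n) tb_tvec \<Rightarrow> ('q, 'n) tb_tvec" where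
  "natural_structure Q y = chart_tensor Q (natural_chart_at Q y) y"

definition natural_liouville ::
  "('q, real^'n::finite) chart set \<Rightarrow> ('q, 'n) tb \<Rightarrow> ('q, 'n) tb_tvec" where
  "natural_liouville Q y = chart_liouville Q (natural_chart_at Q y) y"

text \<open>Charts \<open>(x, u)\<close> in which \<open>S = \<Sum>\<^sub>i \<partial>/\<partial>u\<^sup>i \<otimes> dx\<^sup>i\<close> and \<open>u\<close> vanishes on the zero section.
  The domain is required to be a union of fibres of the tangent bundle: on a domain that misses
  the zero section (in part of a fibre), the second condition would not determine \<open>u\<close>, nor
  \<open>\<Sum>\<^sub>i u\<^sup>i \<partial>/\<partial>u\<^sup>i\<close>.\<close>

definition adapted_charts ::
  "('q, real^'n::finite) chart set \<Rightarrow>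
     (('q, 'n) tb \<Rightarrow> ('q, 'n) tb_tvec \<Rightarrow> ('q, 'n) tb_tvec) \<Rightarrow> ('q, 'n) tb_chart set" where
  "adapted_charts Q S = {d \<in> charts (tangent_bundle Q).
     fst d = {y \<in> carrier (tangent_bundle Q). fst y \<in> fst ` fst d} \<and>
     (\<forall>y\<in>fst d. \<forall>w\<in>tangent_space (tangent_bundle Q) y. S y w = chart_tensor Q d y w) \<and>
     (\<forall>q. (q, 0) \<in> fst d \<longrightarrow> snd (snd d (q, 0)) = 0)}"

definition is_liouville_of ::
  "('q, real^'n::finite) chart set \<Rightarrow>
     (('q, 'n) tb \<Rightarrow> ('q, 'n) tb_tvec \<Rightarrow> ('q, 'n) tb_tvec) \<Rightarrow>
     (('q, 'n) tb \<Rightarrow> ('q, 'n) tb_tvec) \<Rightarrow> bool" where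
  "is_liouville_of Q S D \<longleftrightarrow> vector_field (tangent_bundle Q) D \<and>
     (\<forall>y\<in>carrier (tangent_bundle Q). \<exists>d\<in>adapted_charts Q S. y \<in> fst d) \<and>
     (\<forall>d\<in>adapted_charts Q S. \<forall>y\<in>fst d. D y = chart_liouville Q d y)"

text \<open>SODE vector fields with respect to a tensor field \<open>S\<close> with Liouville vector field \<open>D\<close>.\<close>

definition is_sode ::
  "('q, real^'n::finite) chart set \<Rightarrow>
     (('q, 'n) tb \<Rightarrow> ('q, 'n) tb_tvec \<Rightarrow> ('q, 'n) tb_tvec) \<Rightarrow>
     (('q, 'n) tb \<Rightarrow> ('q, 'n) tb_tvec) \<Rightarrow> (('q, 'n) tb \<Rightarrow> ('q, 'n) tb_tvec) \<Rightarrow> bool" where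
  "is_sode Q S D X \<longleftrightarrow> vector_field (tangent_bundle Q) X \<and>
     (\<forall>y\<in>carrier (tangent_bundle Q). S y (X y) = D y)"

end

(* Over a base chart (x, v), the scaled chart (x, f v) is a chart of the tangent bundle, and f^{-1} S
   has constant coefficients J(a, b) = (0, a) in it. Since J is linear with kernel equal to image, the
   almost tangent property and, because J J = 0, the vanishing of the Nijenhuis tensor are read off in
   these charts, once the Lie bracket is known to be independent of the chart (symmetry of second
   derivatives). The coefficients of f \<Gamma> in scaled coordinates come from the derivative
   (a, b) |-> (a, df(a) v + f b) of the change of coordinates (x, v) |-> (x, f v). *)

theory Submission
  imports Defs
begin

section \<open>Smooth maps\<close>

text \<open>The scaling is forced: for u = f v one has d/dv = f d/du while dx is unchanged, so
  f^{-1} S loses its coefficient, whereas u d/du = v d/dv shows that the Liouville field does not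
  feel f. A natural chart is a scaled chart with factor 1, so changes of charts are computed once,
  between scaled charts with arbitrary nowhere vanishing factors g and h.

  The main obstacle lies in \<open>is_liouville_of\<close>: it speaks of every adapted chart of
  f^{-1} S, not only of the scaled ones. About such a chart nothing is known beyond smoothness and
  the shape of the tensor in it, and its fibre coordinates must be shown to be linear along every
  ray of a fibre.

  The other difficulty is the maximal atlas. Vector fields, tensor fields and brackets refer to all
  of its charts, while computations are possible only in special ones. Two facts bridge the gap: a
  tangent vector is determined by its components in a single chart, and smoothness in one chart
  around each point carries over to all charts.\<close>

lemma frechet_derivative_eqI: "(f has_derivative f') (at x) \<Longrightarrow> frechet_derivative f (at x) = f'"
  by (metis frechet_derivative_at)

lemma has_derivative_frechet_derivative: "f differentiable (at x) \<Longrightarrow> (f has_derivative frechet_derivative f (at x)) (at x)"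
  by (simp add: frechet_derivative_works)

lemma differentiable_cong_open:
  assumes "open S" "x \<in> S" "\<And>y. y \<in> S \<Longrightarrow> f y = g y"
  shows "f differentiable (at x) \<longleftrightarrow> g differentiable (at x)"
    and "frechet_derivative f (at x) = frechet_derivative g (at x)"
proof -
  have "(f has_derivative f') (at x) \<longleftrightarrow> (g has_derivative f') (at x)" for f'
    using has_derivative_transform_within_open[OF _ assms(1,2), of f f' UNIV g]
      has_derivative_transform_within_open[OF _ assms(1,2), of g f' UNIV f] assms(3)
    by auto
  then show "f differentiable (at x) \<longleftrightarrow> g differentiable (at x)"
    "frechet_derivative f (at x) = frechet_derivative g (at x)"
    by (auto simp: differentiable_def frechet_derivative_def)
qed

text \<open>A derivative sees only a neighbourhood of its point, so on an open set agreement of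
  \<open>f\<close> and \<open>g\<close> passes to their directional derivatives, which are the
  functions of the next lower level.\<close>

lemma C_diff_on_cong:
  assumes "open S" "\<And>x. x \<in> S \<Longrightarrow> f x = g x" "C_diff_on k S f"
  shows "C_diff_on k S g"
  using assms(2,3)
proof (induction k arbitrary: f g)
  case 0
  then show ?case
    by (simp cong: continuous_on_cong)
next
  case (Suc k)
  have 1: "\<forall>x\<in>S. g differentiable (at x)"
  proof
    fix x assume "x \<in> S"
    then show "g differentiable (at x)"
      using differentiable_cong_open(1)[OF assms(1), of x f g] Suc.prems by simp
  qed
  have 2: "frechet_derivative f (at x) h = frechet_derivative g (at x) h" if "x \<in> S" for x h
    using differentiable_cong_open(2)[OF assms(1) that, of f g, OF Suc.prems(1)] by simp
  have "C_diff_on k S (\<lambda>x. frechet_derivative g (at x) h)" for h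
    by (rule Suc.IH[where f = "\<lambda>x. frechet_derivative f (at x) h"]) (use 2 Suc.prems in auto)
  then show ?case
    using 1 by simp
qed

lemma C_diff_on_subset: "C_diff_on k S f \<Longrightarrow> T \<subseteq> S \<Longrightarrow> C_diff_on k T f"
  by (induction k arbitrary: f) (auto intro: continuous_on_subset)

text \<open>Continuity and differentiability at a point are local. This is what allows smoothness to
  be proved on overlaps of charts and then glued.\<close>

lemma C_diff_on_local:
  assumes "\<And>x. x \<in> S \<Longrightarrow> \<exists>T. open T \<and> x \<in> T \<and> C_diff_on k T f"
  shows "C_diff_on k S f"
  using assms
proof (induction k arbitrary: f)
  case 0
  then have "\<exists>T. open T \<and> x \<in> T \<and> continuous_on T f" if "x \<in> S" for x
    using that by simp
  then have "continuous (at x) f" if "x \<in> S" for x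
    using that by (metis continuous_on_eq_continuous_at)
  then show ?case
    by (simp add: continuous_at_imp_continuous_on)
next
  case (Suc k)
  then have *: "\<exists>T. open T \<and> x \<in> T \<and> C_diff_on (Suc k) T f" if "x \<in> S" for x
    using that by blast
  have "C_diff_on k S (\<lambda>x. frechet_derivative f (at x) h)" for h
    by (rule Suc.IH) (use * in fastforce)
  moreover have "f differentiable (at x)" if "x \<in> S" for x
    using *[OF that] by auto
  ultimately show ?case
    by simp
qed

lemma C_diff_on_SucD: "C_diff_on (Suc k) S f \<Longrightarrow> C_diff_on k S f"
proof (induction k arbitrary: f)
  case 0
  then show ?case
    by (simp add: continuous_at_imp_continuous_on differentiable_imp_continuous_within)
next
  case (Suc k)
  then show ?case
    by (metis C_diff_on.simps(2))
qed

lemma C_diff_on_const: "C_diff_on k S (\<lambda>_. c)"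
  by (induction k arbitrary: c) auto

lemma C_diff_on_bounded_linear:
  assumes "bounded_linear L" "C_diff_on k S f" "open S"
  shows "C_diff_on k S (\<lambda>x. L (f x))"
  using assms(2)
proof (induction k arbitrary: f)
  case 0
  then show ?case
    by (simp add: bounded_linear.continuous_on[OF assms(1)])
next
  case (Suc k)
  have D: "((\<lambda>x. L (f x)) has_derivative (\<lambda>h. L (frechet_derivative f (at x) h))) (at x)" if "x \<in> S" for x
    using Suc.prems that
    by (auto intro!: bounded_linear.has_derivative[OF assms(1)] has_derivative_frechet_derivative)
  have "C_diff_on k S (\<lambda>x. frechet_derivative (\<lambda>x. L (f x)) (at x) h)" for h
  proof (rule C_diff_on_cong[OF assms(3)])
    show "C_diff_on k S (\<lambda>x. L (frechet_derivative f (at x) h))"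
      using Suc by simp
  qed (simp add: frechet_derivative_eqI[OF D])
  then show ?case
    using D by (auto simp: differentiable_def)
qed

lemma C_diff_on_add:
  assumes "C_diff_on k S f" "C_diff_on k S g" "open S"
  shows "C_diff_on k S (\<lambda>x. f x + g x)"
  using assms(1,2)
proof (induction k arbitrary: f g)
  case 0
  then show ?case
    by (simp add: continuous_on_add)
next
  case (Suc k)
  have D: "((\<lambda>x. f x + g x) has_derivative
      (\<lambda>h. frechet_derivative f (at x) h + frechet_derivative g (at x) h)) (at x)" if "x \<in> S" for x
    using Suc.prems that by (auto intro!: has_derivative_add has_derivative_frechet_derivative)
  have "C_diff_on k S (\<lambda>x. frechet_derivative (\<lambda>x. f x + g x) (at x) h)" for h
  proof (rule C_diff_on_cong[OF assms(3)])
    show "C_diff_on k S (\<lambda>x. frechet_derivative f (at x) h + frechet_derivative g (at x) h)"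
      using Suc by simp
  qed (simp add: frechet_derivative_eqI[OF D])
  then show ?case
    using D by (auto simp: differentiable_def)
qed

lemma C_diff_on_sum:
  assumes "\<And>i. i \<in> I \<Longrightarrow> C_diff_on k S (f i)" "open S"
  shows "C_diff_on k S (\<lambda>x. \<Sum>i\<in>I. f i x)"
  using assms(1)
proof (induction I rule: infinite_finite_induct)
  case (insert i I)
  then show ?case
    using C_diff_on_add[OF insert.prems[of i] insert.IH assms(2)] by simp
qed (simp_all add: C_diff_on_const)

text \<open>By the Leibniz rule the derivative is a sum of two terms of the same form
  \<open>B (...) (...)\<close>. In each of them one factor is not differentiated, hence the use of
  \<open>C_diff_on_SucD\<close>.\<close>

lemma C_diff_on_bounded_bilinear:
  assumes "bounded_bilinear B" "C_diff_on k S f" "C_diff_on k S g" "open S"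
  shows "C_diff_on k S (\<lambda>x. B (f x) (g x))"
  using assms(2,3)
proof (induction k arbitrary: f g)
  case 0
  then show ?case
    by (simp add: bounded_bilinear.continuous_on[OF assms(1)])
next
  case (Suc k)
  have D: "((\<lambda>x. B (f x) (g x)) has_derivative
      (\<lambda>h. B (f x) (frechet_derivative g (at x) h) + B (frechet_derivative f (at x) h) (g x))) (at x)"
    if "x \<in> S" for x
    using Suc.prems that
    by (auto intro!: bounded_bilinear.FDERIV[OF assms(1)] has_derivative_frechet_derivative)
  have "C_diff_on k S (\<lambda>x. frechet_derivative (\<lambda>x. B (f x) (g x)) (at x) h)" for h
  proof (rule C_diff_on_cong[OF assms(4)])
    show "C_diff_on k S
        (\<lambda>x. B (f x) (frechet_derivative g (at x) h) + B (frechet_derivative f (at x) h) (g x))"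
      using Suc C_diff_on_SucD[OF Suc.prems(1)] C_diff_on_SucD[OF Suc.prems(2)]
      by (intro C_diff_on_add assms(4) Suc.IH) auto
  qed (simp add: frechet_derivative_eqI[OF D])
  then show ?case
    using D by (auto simp: differentiable_def)
qed

lemma linear_apply_Basis_sum:
  fixes x :: "'a::euclidean_space"
  assumes "linear L"
  shows "L x = (\<Sum>b\<in>Basis. (x \<bullet> b) *\<^sub>R L b)"
proof -
  have "L x = L (\<Sum>b\<in>Basis. (x \<bullet> b) *\<^sub>R b)"
    by (simp add: euclidean_representation)
  also have "\<dots> = (\<Sum>b\<in>Basis. (x \<bullet> b) *\<^sub>R L b)"
    by (simp add: linear_sum[OF assms] linear_scale[OF assms])
  finally show ?thesis .
qed

text \<open>The chain rule applies the derivative of \<open>g\<close> to a vector that varies with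
  \<open>x\<close>, but \<open>C_diff_on\<close> controls derivatives in fixed directions only.
  Expanding that vector in \<open>Basis\<close> leaves sums of products of scalar functions with
  derivatives of \<open>g\<close> in fixed directions, to which the induction hypothesis
  applies.\<close>

lemma C_diff_on_compose:
  fixes f :: "'a::euclidean_space \<Rightarrow> 'b::euclidean_space" and g :: "'b \<Rightarrow> 'c::real_normed_vector"
  assumes "C_diff_on k T g" "C_diff_on k S f" "open S" "f ` S \<subseteq> T"
  shows "C_diff_on k S (\<lambda>x. g (f x))"
  using assms(1,2)
proof (induction k arbitrary: g)
  case 0
  then show ?case
    using continuous_on_compose2 assms(4) by (metis C_diff_on.simps(1))
next
  case (Suc k)
  have D: "((\<lambda>x. g (f x)) has_derivative
      (\<lambda>h. frechet_derivative g (at (f x)) (frechet_derivative f (at x) h))) (at x)" if "x \<in> S" for x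
  proof (rule has_derivative_compose[where f = f and g = g])
    show "(f has_derivative frechet_derivative f (at x)) (at x)"
      using Suc.prems that by (simp add: has_derivative_frechet_derivative)
    show "(g has_derivative frechet_derivative g (at (f x))) (at (f x))"
      using Suc.prems that assms(4) by (auto intro: has_derivative_frechet_derivative)
  qed
  have "C_diff_on k S (\<lambda>x. frechet_derivative (\<lambda>x. g (f x)) (at x) h)" for h
  proof (rule C_diff_on_cong[OF assms(3)])
    show "C_diff_on k S (\<lambda>x. \<Sum>b\<in>Basis. (frechet_derivative f (at x) h \<bullet> b) *\<^sub>R
        frechet_derivative g (at (f x)) b)"
    proof (intro C_diff_on_sum C_diff_on_bounded_bilinear[OF bounded_bilinear_scaleR] assms(3))
      fix b :: 'b
      show "C_diff_on k S (\<lambda>x. frechet_derivative f (at x) h \<bullet> b)"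
        by (rule C_diff_on_bounded_linear[OF bounded_linear_inner_left _ assms(3)])
          (use Suc.prems in simp)
      show "C_diff_on k S (\<lambda>x. frechet_derivative g (at (f x)) b)"
        by (rule Suc.IH) (use Suc.prems C_diff_on_SucD in auto)
    qed
    show "(\<Sum>b\<in>Basis. (frechet_derivative f (at x) h \<bullet> b) *\<^sub>R frechet_derivative g (at (f x)) b) =
        frechet_derivative (\<lambda>x. g (f x)) (at x) h" if "x \<in> S" for x
    proof -
      have "linear (frechet_derivative g (at (f x)))"
        by (rule linear_frechet_derivative) (use Suc.prems that assms(4) in auto)
      from linear_apply_Basis_sum[OF this] show ?thesis
        using frechet_derivative_eqI[OF D[OF that]] by metis
    qed
  qed
  then show ?case
    using D by (auto simp: differentiable_def)
qed

text \<open>The derivative of the reciprocal is a constant times its square, so smoothness of the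
  reciprocal off 0 reproduces itself by induction on the order; the general case is a
  composition.\<close>

lemma C_diff_on_inverse:
  fixes f :: "'a::euclidean_space \<Rightarrow> real"
  assumes "C_diff_on k S f" "\<And>x. x \<in> S \<Longrightarrow> f x \<noteq> 0" "open S"
  shows "C_diff_on k S (\<lambda>x. inverse (f x))"
proof -
  have op: "open (- {0::real})"
    by (simp add: open_Compl)
  have "C_diff_on k (- {0::real}) inverse" for k
  proof (induction k)
    case 0
    then show ?case
      by (auto intro!: continuous_intros)
  next
    case (Suc k)
    have D: "(inverse has_derivative (\<lambda>h. - (inverse x * h * inverse x))) (at x)" if "x \<in> - {0}" for x :: real
      using that by (auto intro: has_derivative_inverse')
    have "C_diff_on k (- {0::real}) (\<lambda>x. frechet_derivative inverse (at x) h)" for h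
    proof (rule C_diff_on_cong[OF op])
      show "C_diff_on k (- {0::real}) (\<lambda>x. (- h) * (inverse x * inverse x))"
        by (intro C_diff_on_bounded_bilinear[OF bounded_bilinear_mult] op Suc C_diff_on_const)
    qed (simp add: frechet_derivative_eqI[OF D])
    then show ?case
      using D by (auto simp: differentiable_def)
  qed
  then show ?thesis
    by (rule C_diff_on_compose[of k "- {0}" inverse S f, OF _ assms(1,3)]) (use assms(2) in auto)
qed

lemma smooth_on_cong:
  "smooth_on S f \<Longrightarrow> open S \<Longrightarrow> (\<And>x. x \<in> S \<Longrightarrow> f x = g x) \<Longrightarrow> smooth_on S g"
  unfolding smooth_on_def using C_diff_on_cong by blast

lemma smooth_on_subset: "smooth_on S f \<Longrightarrow> T \<subseteq> S \<Longrightarrow> smooth_on T f"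
  unfolding smooth_on_def using C_diff_on_subset by blast

lemma smooth_on_local:
  assumes "\<And>x. x \<in> S \<Longrightarrow> \<exists>T. open T \<and> x \<in> T \<and> smooth_on T f"
  shows "smooth_on S f"
  using assms unfolding smooth_on_def by (meson C_diff_on_local)

lemma smooth_on_const: "smooth_on S (\<lambda>_. c)"
  by (simp add: smooth_on_def C_diff_on_const)

lemma smooth_on_bounded_linear:
  "bounded_linear L \<Longrightarrow> smooth_on S f \<Longrightarrow> open S \<Longrightarrow> smooth_on S (\<lambda>x. L (f x))"
  by (simp add: smooth_on_def C_diff_on_bounded_linear)

lemma smooth_on_id: "smooth_on S (\<lambda>x. x)"
  unfolding smooth_on_def
proof
  fix k
  show "C_diff_on k S (\<lambda>x. x)"
    by (cases k) (auto simp: C_diff_on_const)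
qed

lemma smooth_on_linear:
  fixes f :: "'a::euclidean_space \<Rightarrow> 'b::euclidean_space"
  shows "linear L \<Longrightarrow> smooth_on S f \<Longrightarrow> open S \<Longrightarrow> smooth_on S (\<lambda>x. L (f x))"
  by (rule smooth_on_bounded_linear) (simp_all add: linear_conv_bounded_linear)

lemma smooth_on_add:
  "smooth_on S f \<Longrightarrow> smooth_on S g \<Longrightarrow> open S \<Longrightarrow> smooth_on S (\<lambda>x. f x + g x)"
  by (simp add: smooth_on_def C_diff_on_add)

lemma smooth_on_sum:
  "(\<And>i. i \<in> I \<Longrightarrow> smooth_on S (f i)) \<Longrightarrow> open S \<Longrightarrow> smooth_on S (\<lambda>x. \<Sum>i\<in>I. f i x)"
  by (simp add: smooth_on_def C_diff_on_sum)

lemma smooth_on_scaleR: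
  "smooth_on S f \<Longrightarrow> smooth_on S g \<Longrightarrow> open S \<Longrightarrow> smooth_on S (\<lambda>x. f x *\<^sub>R g x)"
  by (simp add: smooth_on_def C_diff_on_bounded_bilinear[OF bounded_bilinear_scaleR])

lemma smooth_on_mult:
  fixes f g :: "'a::euclidean_space \<Rightarrow> real"
  shows "smooth_on S f \<Longrightarrow> smooth_on S g \<Longrightarrow> open S \<Longrightarrow> smooth_on S (\<lambda>x. f x * g x)"
  using smooth_on_scaleR[of S f g] by simp

lemma smooth_on_compose:
  fixes f :: "'a::euclidean_space \<Rightarrow> 'b::euclidean_space"
  shows "smooth_on T g \<Longrightarrow> smooth_on S f \<Longrightarrow> open S \<Longrightarrow> (\<And>x. x \<in> S \<Longrightarrow> f x \<in> T) \<Longrightarrow>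
    smooth_on S (\<lambda>x. g (f x))"
  unfolding smooth_on_def using C_diff_on_compose by (metis image_subsetI)

lemma smooth_on_inverse:
  fixes f :: "'a::euclidean_space \<Rightarrow> real"
  shows "smooth_on S f \<Longrightarrow> (\<And>x. x \<in> S \<Longrightarrow> f x \<noteq> 0) \<Longrightarrow> open S \<Longrightarrow> smooth_on S (\<lambda>x. inverse (f x))"
  by (simp add: smooth_on_def C_diff_on_inverse)

lemma smooth_on_Pair:
  fixes f :: "'a::euclidean_space \<Rightarrow> 'b::euclidean_space" and g :: "'a \<Rightarrow> 'c::euclidean_space"
  assumes "smooth_on S f" "smooth_on S g" "open S"
  shows "smooth_on S (\<lambda>x. (f x, g x))"
proof -
  have "smooth_on S (\<lambda>x. (f x, 0) + (0, g x))"
    by (intro smooth_on_add smooth_on_linear[OF _ assms(1,3), of "\<lambda>x. (x, 0)"]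
        smooth_on_linear[OF _ assms(2,3), of "\<lambda>x. (0, x)"] assms(3))
      (auto intro!: linearI)
  then show ?thesis
    by simp
qed

lemma smooth_on_fst: "open S \<Longrightarrow> smooth_on S fst"
  by (rule smooth_on_bounded_linear[OF bounded_linear_fst smooth_on_id])

lemma smooth_on_snd: "open S \<Longrightarrow> smooth_on S snd"
  by (rule smooth_on_bounded_linear[OF bounded_linear_snd smooth_on_id])

lemma smooth_on_differentiable: "smooth_on S f \<Longrightarrow> x \<in> S \<Longrightarrow> f differentiable (at x)"
  unfolding smooth_on_def by (metis C_diff_on.simps(2))

lemma smooth_on_continuous: "smooth_on S f \<Longrightarrow> continuous_on S f"
  unfolding smooth_on_def by (metis C_diff_on.simps(1))

lemma smooth_on_frechet: "smooth_on S f \<Longrightarrow> smooth_on S (\<lambda>x. frechet_derivative f (at x) h)"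
  unfolding smooth_on_def by (metis C_diff_on.simps(2))

text \<open>Both the base point \<open>u z\<close> and the direction \<open>w z\<close> vary. As in
  the chain rule, expanding the direction in \<open>Basis\<close> separates the two
  dependences.\<close>

lemma smooth_on_frechet_apply:
  fixes f :: "'a::euclidean_space \<Rightarrow> 'b::real_normed_vector" and u :: "'c::euclidean_space \<Rightarrow> 'a"
  assumes "smooth_on S f" "smooth_on T u" "smooth_on T w" "open T" "\<And>z. z \<in> T \<Longrightarrow> u z \<in> S"
  shows "smooth_on T (\<lambda>z. frechet_derivative f (at (u z)) (w z))"
proof (rule smooth_on_cong)
  show "smooth_on T (\<lambda>z. \<Sum>b\<in>Basis. (w z \<bullet> b) *\<^sub>R frechet_derivative f (at (u z)) b)"
  proof (intro smooth_on_sum smooth_on_scaleR assms(4))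
    show "smooth_on T (\<lambda>z. w z \<bullet> b)" for b
      by (rule smooth_on_bounded_linear[OF bounded_linear_inner_left assms(3,4)])
    show "smooth_on T (\<lambda>z. frechet_derivative f (at (u z)) b)" for b
      by (rule smooth_on_compose[OF smooth_on_frechet[OF assms(1)] assms(2,4)]) (rule assms(5))
  qed
  show "(\<Sum>b\<in>Basis. (w z \<bullet> b) *\<^sub>R frechet_derivative f (at (u z)) b) =
      frechet_derivative f (at (u z)) (w z)" if "z \<in> T" for z
    using linear_apply_Basis_sum[of "frechet_derivative f (at (u z))" "w z"]
      linear_frechet_derivative[OF smooth_on_differentiable[OF assms(1) assms(5)[OF that]]]
    by metis
qed (rule assms(4))

section \<open>Symmetry of second derivatives, and differentiation of z |-> Df(z)(w(z))\<close>

lemma has_vector_derivative_along_line: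
  assumes "f differentiable (at (y + s *\<^sub>R a))"
  shows "((\<lambda>s. f (y + s *\<^sub>R a)) has_vector_derivative frechet_derivative f (at (y + s *\<^sub>R a)) a) (at s)"
proof -
  have "((\<lambda>s. f (y + s *\<^sub>R a)) has_derivative
      (\<lambda>h. frechet_derivative f (at (y + s *\<^sub>R a)) (h *\<^sub>R a))) (at s)"
  proof (rule has_derivative_compose[where f = "\<lambda>s. y + s *\<^sub>R a" and g = f])
    show "((\<lambda>s. y + s *\<^sub>R a) has_derivative (\<lambda>h. h *\<^sub>R a)) (at s)"
      by (auto intro!: derivative_eq_intros)
    show "(f has_derivative frechet_derivative f (at (y + s *\<^sub>R a))) (at (y + s *\<^sub>R a))"
      by (rule has_derivative_frechet_derivative[OF assms])
  qed
  then show ?thesis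
    using linear_scale[OF linear_frechet_derivative[OF assms]]
    by (simp add: has_vector_derivative_def)
qed

text \<open>The mean value theorem is used twice, along \<open>a\<close> for a difference of two
  values of \<open>f\<close> and along \<open>b\<close> for the derivative it produces. The second
  difference on the left is symmetric in \<open>a\<close> and \<open>b\<close>, the derivative on
  the right is not visibly so.\<close>

lemma second_difference_mean_value:
  fixes f :: "'a::euclidean_space \<Rightarrow> real"
  assumes f: "smooth_on (ball x r) f" and t: "t > 0" "t * (norm a + norm b) < r"
  shows "\<exists>p. dist p x \<le> t * (norm a + norm b) \<and>
    f (x + t *\<^sub>R a + t *\<^sub>R b) - f (x + t *\<^sub>R a) - f (x + t *\<^sub>R b) + f x =
      t * t * frechet_derivative (\<lambda>y. frechet_derivative f (at y) a) (at p) b"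
proof -
  let ?Da = "\<lambda>y. frechet_derivative f (at y) a"
  have near: "dist (x + u *\<^sub>R a + v *\<^sub>R b) x \<le> t * (norm a + norm b)"
    if "0 \<le> u" "u \<le> t" "0 \<le> v" "v \<le> t" for u v
  proof -
    have "norm (u *\<^sub>R a + v *\<^sub>R b) \<le> u * norm a + v * norm b"
      using norm_triangle_ineq[of "u *\<^sub>R a" "v *\<^sub>R b"] that by simp
    also have "\<dots> \<le> t * norm a + t * norm b"
      using that by (intro add_mono mult_right_mono) auto
    finally show ?thesis
      by (simp add: dist_norm algebra_simps)
  qed
  have inb: "x + u *\<^sub>R a + v *\<^sub>R b \<in> ball x r" if "0 \<le> u" "u \<le> t" "0 \<le> v" "v \<le> t" for u v
    using near[OF that] t(2) by (simp add: dist_commute)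
  have d1: "((\<lambda>s. f (y + s *\<^sub>R a)) has_real_derivative ?Da (y + s *\<^sub>R a)) (at s)"
    if "y + s *\<^sub>R a \<in> ball x r" for y s
    using has_vector_derivative_along_line[OF smooth_on_differentiable[OF f that]]
    by (simp add: has_real_derivative_iff_has_vector_derivative)
  have d2: "((\<lambda>s. ?Da (y + s *\<^sub>R b)) has_real_derivative
      frechet_derivative ?Da (at (y + s *\<^sub>R b)) b) (at s)"
    if "y + s *\<^sub>R b \<in> ball x r" for y s
    using has_vector_derivative_along_line[OF smooth_on_differentiable[OF smooth_on_frechet[OF f] that]]
    by (simp add: has_real_derivative_iff_has_vector_derivative)
  \<comment> \<open>Chosen so that \<open>?g t - ?g 0\<close> is the second difference.\<close>
  let ?g = "\<lambda>s. f ((x + t *\<^sub>R b) + s *\<^sub>R a) - f (x + s *\<^sub>R a)"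
  let ?g' = "\<lambda>s. ?Da ((x + t *\<^sub>R b) + s *\<^sub>R a) - ?Da (x + s *\<^sub>R a)"
  have "\<exists>\<xi>. 0 < \<xi> \<and> \<xi> < t \<and> ?g t - ?g 0 = (t - 0) * ?g' \<xi>"
  proof (rule MVT2[OF t(1)])
    fix s assume s: "0 \<le> s" "s \<le> t"
    show "(?g has_real_derivative ?g' s) (at s)"
      by (intro DERIV_diff d1)
        (use s inb[of s t] inb[of s 0] t in \<open>simp_all add: algebra_simps\<close>)
  qed
  then obtain \<xi> where \<xi>: "0 < \<xi>" "\<xi> < t" "?g t - ?g 0 = t * ?g' \<xi>"
    by auto
  let ?k = "\<lambda>s. ?Da ((x + \<xi> *\<^sub>R a) + s *\<^sub>R b)"
  let ?k' = "\<lambda>s. frechet_derivative ?Da (at ((x + \<xi> *\<^sub>R a) + s *\<^sub>R b)) b"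
  have "\<exists>\<eta>. 0 < \<eta> \<and> \<eta> < t \<and> ?k t - ?k 0 = (t - 0) * ?k' \<eta>"
  proof (rule MVT2[OF t(1)])
    fix s assume s: "0 \<le> s" "s \<le> t"
    show "(?k has_real_derivative ?k' s) (at s)"
      by (rule d2) (use s inb[of \<xi> s] \<xi> in simp)
  qed
  then obtain \<eta> where \<eta>: "0 < \<eta>" "\<eta> < t" "?k t - ?k 0 = t * ?k' \<eta>"
    by auto
  have "?g t - ?g 0 = t * t * ?k' \<eta>"
    using \<xi>(3) \<eta>(3) by (simp add: algebra_simps)
  then show ?thesis
    using near[of \<xi> \<eta>] \<xi> \<eta>
    by (intro exI[of _ "x + \<xi> *\<^sub>R a + \<eta> *\<^sub>R b"]) (simp add: algebra_simps)
qed

text \<open>One and the same second difference equals t^2 times each mixed derivative, taken at two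
  points \<open>p\<close> and \<open>q\<close> near \<open>x\<close>. Continuity of the mixed
  derivatives then excludes a gap at \<open>x\<close>.\<close>

lemma second_derivative_symmetric_real:
  fixes f :: "'a::euclidean_space \<Rightarrow> real"
  assumes "smooth_on S f" "open S" "x \<in> S"
  shows "frechet_derivative (\<lambda>y. frechet_derivative f (at y) a) (at x) b =
    frechet_derivative (\<lambda>y. frechet_derivative f (at y) b) (at x) a"
proof (rule ccontr)
  let ?H = "\<lambda>a b p. frechet_derivative (\<lambda>y. frechet_derivative f (at y) a) (at p) b"
  assume ne: "?H a b x \<noteq> ?H b a x"
  \<comment> \<open>Half of the gap: equal values strictly within \<open>e\<close> of both ends are
    impossible.\<close>
  define e where "e = \<bar>?H a b x - ?H b a x\<bar> / 2"
  have e: "e > 0"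
    using ne by (simp add: e_def)
  have "isCont (?H a b) x" for a b
    using smooth_on_continuous[OF smooth_on_frechet[OF smooth_on_frechet[OF assms(1)]]] assms(2,3)
    by (simp add: continuous_on_eq_continuous_at)
  then have "\<exists>d>0. \<forall>p. dist p x < d \<longrightarrow> dist (?H a b p) (?H a b x) < e" for a b
    using e unfolding continuous_at_eps_delta by blast
  then obtain d1 d2 where d: "d1 > 0" "d2 > 0"
      "\<And>p. dist p x < d1 \<Longrightarrow> dist (?H a b p) (?H a b x) < e"
      "\<And>p. dist p x < d2 \<Longrightarrow> dist (?H b a p) (?H b a x) < e"
    by metis
  obtain r0 where r0: "r0 > 0" "ball x r0 \<subseteq> S"
    using assms(2,3) openE by blast
  define r where "r = min r0 (min d1 d2)"
  have r: "r > 0" "r \<le> d1" "r \<le> d2"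
    using d r0 by (auto simp: r_def)
  have "ball x r \<subseteq> S"
    using r0(2) by (auto simp: r_def)
  then have f: "smooth_on (ball x r) f"
    by (rule smooth_on_subset[OF assms(1)])
  \<comment> \<open>The summand 1 keeps the denominator positive when both directions vanish, and
    makes the bound \<open>t * (norm a + norm b) < r\<close> strict.\<close>
  define t where "t = r / (norm a + norm b + 1)"
  have pos: "norm a + norm b + 1 > 0"
    by (simp add: add_nonneg_pos)
  have t: "t > 0" "t * (norm a + norm b) < r"
    using r(1) pos by (simp_all add: t_def field_simps)
  obtain p where p: "dist p x \<le> t * (norm a + norm b)"
    "f (x + t *\<^sub>R a + t *\<^sub>R b) - f (x + t *\<^sub>R a) - f (x + t *\<^sub>R b) + f x = t * t * ?H a b p"
    using second_difference_mean_value[OF f t] by blast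
  have t': "t * (norm b + norm a) < r"
    using t by (simp add: add.commute)
  obtain q where q: "dist q x \<le> t * (norm b + norm a)"
    "f (x + t *\<^sub>R b + t *\<^sub>R a) - f (x + t *\<^sub>R b) - f (x + t *\<^sub>R a) + f x = t * t * ?H b a q"
    using second_difference_mean_value[OF f t(1) t'] by blast
  have comm: "x + t *\<^sub>R b + t *\<^sub>R a = x + t *\<^sub>R a + t *\<^sub>R b"
    by simp
  have "t * t * ?H a b p = t * t * ?H b a q"
    using p(2) q(2) unfolding comm by linarith
  then have "?H a b p = ?H b a q"
    using t(1) by simp
  moreover have "dist (?H a b p) (?H a b x) < e" "dist (?H b a q) (?H b a x) < e"
    using p(1) q(1) t t' r by (auto intro!: d)
  ultimately show False
    unfolding e_def dist_real_def by (smt (verit) field_sum_of_halves)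
qed

lemma second_derivative_symmetric:
  fixes f :: "'a::euclidean_space \<Rightarrow> 'b::euclidean_space"
  assumes "smooth_on S f" "open S" "x \<in> S"
  shows "frechet_derivative (\<lambda>y. frechet_derivative f (at y) a) (at x) b =
    frechet_derivative (\<lambda>y. frechet_derivative f (at y) b) (at x) a"
proof (rule euclidean_eqI)
  fix i :: 'b assume "i \<in> Basis"
  have inner: "frechet_derivative (\<lambda>y. g y \<bullet> i) (at y) h = frechet_derivative g (at y) h \<bullet> i"
    if "g differentiable (at y)" for g :: "'a \<Rightarrow> 'b" and y h
    using frechet_derivative_eqI[OF bounded_linear.has_derivative[OF bounded_linear_inner_left has_derivative_frechet_derivative[OF that]]]
    by metis
  have *: "frechet_derivative (\<lambda>y. frechet_derivative (\<lambda>y. f y \<bullet> i) (at y) a) (at x) b =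
      frechet_derivative (\<lambda>y. frechet_derivative f (at y) a) (at x) b \<bullet> i" for a b
  proof -
    have "frechet_derivative (\<lambda>y. frechet_derivative (\<lambda>y. f y \<bullet> i) (at y) a) (at x) =
        frechet_derivative (\<lambda>y. frechet_derivative f (at y) a \<bullet> i) (at x)"
      by (rule differentiable_cong_open(2)[OF assms(2,3)])
        (rule inner, rule smooth_on_differentiable[OF assms(1)])
    then show ?thesis
      using inner[OF smooth_on_differentiable[OF smooth_on_frechet[OF assms(1)] assms(3)]] by simp
  qed
  show "frechet_derivative (\<lambda>y. frechet_derivative f (at y) a) (at x) b \<bullet> i =
      frechet_derivative (\<lambda>y. frechet_derivative f (at y) b) (at x) a \<bullet> i"
    using second_derivative_symmetric_real[OF
        smooth_on_bounded_linear[OF bounded_linear_inner_left assms(1,2)] assms(2,3)] *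
    by metis
qed

lemma has_derivative_frechet_apply:
  fixes f :: "'a::euclidean_space \<Rightarrow> 'b::euclidean_space"
  assumes f: "smooth_on S f" "open S" "x \<in> S" and w: "(w has_derivative w') (at x)"
  shows "((\<lambda>y. frechet_derivative f (at y) (w y)) has_derivative
    (\<lambda>h. frechet_derivative f (at x) (w' h) +
      frechet_derivative (\<lambda>y. frechet_derivative f (at y) (w x)) (at x) h)) (at x)"
proof (rule has_derivative_transform_within_open[OF _ f(2,3)])
  have lin: "linear (frechet_derivative f (at y))" if "y \<in> S" for y
    by (rule linear_frechet_derivative[OF smooth_on_differentiable[OF f(1) that]])
  show "(\<Sum>b\<in>Basis. (w y \<bullet> b) *\<^sub>R frechet_derivative f (at y) b) = frechet_derivative f (at y) (w y)"
    if "y \<in> S" for y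
    using linear_apply_Basis_sum[OF lin[OF that]] by metis
  have D: "((\<lambda>y. frechet_derivative f (at y) b) has_derivative
      frechet_derivative (\<lambda>y. frechet_derivative f (at y) b) (at x)) (at x)" for b
    by (rule has_derivative_frechet_derivative[OF smooth_on_differentiable[OF smooth_on_frechet[OF f(1)] f(3)]])
  have wx: "frechet_derivative (\<lambda>y. frechet_derivative f (at y) (w x)) (at x) h =
      (\<Sum>b\<in>Basis. (w x \<bullet> b) *\<^sub>R frechet_derivative (\<lambda>y. frechet_derivative f (at y) b) (at x) h)" for h
  proof -
    have "frechet_derivative (\<lambda>y. frechet_derivative f (at y) (w x)) (at x) =
        frechet_derivative (\<lambda>y. \<Sum>b\<in>Basis. (w x \<bullet> b) *\<^sub>R frechet_derivative f (at y) b) (at x)"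
      by (rule differentiable_cong_open(2)[OF f(2,3)]) (use linear_apply_Basis_sum[OF lin] in metis)
    moreover have "((\<lambda>y. \<Sum>b\<in>Basis. (w x \<bullet> b) *\<^sub>R frechet_derivative f (at y) b) has_derivative
        (\<lambda>h. \<Sum>b\<in>Basis. (w x \<bullet> b) *\<^sub>R
          frechet_derivative (\<lambda>y. frechet_derivative f (at y) b) (at x) h)) (at x)"
      by (intro has_derivative_sum has_derivative_scaleR_right D)
    ultimately show ?thesis
      by (simp add: frechet_derivative_eqI)
  qed
  have "((\<lambda>y. \<Sum>b\<in>Basis. (w y \<bullet> b) *\<^sub>R frechet_derivative f (at y) b) has_derivative
      (\<lambda>h. \<Sum>b\<in>Basis. (w x \<bullet> b) *\<^sub>R frechet_derivative (\<lambda>y. frechet_derivative f (at y) b) (at x) h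
        + (w' h \<bullet> b) *\<^sub>R frechet_derivative f (at x) b)) (at x)"
    by (intro has_derivative_sum has_derivative_scaleR D
        bounded_linear.has_derivative[OF bounded_linear_inner_left w])
  moreover have "(\<Sum>b\<in>Basis. (w x \<bullet> b) *\<^sub>R frechet_derivative (\<lambda>y. frechet_derivative f (at y) b) (at x) h
        + (w' h \<bullet> b) *\<^sub>R frechet_derivative f (at x) b) =
      frechet_derivative f (at x) (w' h) +
      frechet_derivative (\<lambda>y. frechet_derivative f (at y) (w x)) (at x) h" for h
    using linear_apply_Basis_sum[OF lin[OF f(3)], of "w' h"] wx[of h]
    by (simp add: sum.distrib add.commute)
  ultimately show "((\<lambda>y. \<Sum>b\<in>Basis. (w y \<bullet> b) *\<^sub>R frechet_derivative f (at y) b) has_derivative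
      (\<lambda>h. frechet_derivative f (at x) (w' h) +
      frechet_derivative (\<lambda>y. frechet_derivative f (at y) (w x)) (at x) h)) (at x)"
    by simp
qed

section \<open>Calculus on a manifold\<close>

abbreviation jacobian :: "('m, 'e::euclidean_space) chart \<Rightarrow> ('m, 'e) chart \<Rightarrow> 'm \<Rightarrow> 'e \<Rightarrow> 'e" where
  "jacobian c d p \<equiv> frechet_derivative (transition c d) (at (snd c p))"

text \<open>Literally the expression inside \<open>vector_field\<close> and
  \<open>lie_bracket\<close>, so that unfolding those definitions produces it.\<close>

abbreviation rep :: "('m, 'e) chart \<Rightarrow> ('m \<Rightarrow> ('m, 'e) tvec) \<Rightarrow> 'e \<Rightarrow> 'e" where
  "rep c X \<equiv> \<lambda>z. comps (X (inv_into (fst c) (snd c) z)) c"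

lemma inv_into_chart: "is_chart c \<Longrightarrow> p \<in> fst c \<Longrightarrow> inv_into (fst c) (snd c) (snd c p) = p"
  by (simp add: is_chart_def)

lemma transition_apply: "is_chart c \<Longrightarrow> p \<in> fst c \<Longrightarrow> transition c d (snd c p) = snd d p"
  by (simp add: transition_def inv_into_chart)

lemma chart_image_Int:
  "is_chart c \<Longrightarrow> snd c ` (fst c \<inter> U \<inter> V) = snd c ` (fst c \<inter> U) \<inter> snd c ` (fst c \<inter> V)"
  by (auto simp: is_chart_def inj_on_def)

text \<open>The transition from \<open>c\<close> to \<open>d\<close> factors through a chart \<open>a\<close> of the atlas near each point.\<close>

lemma compatible_through:
  assumes "is_chart c" "is_chart a" "compatible c a" "compatible d a" "p \<in> fst c" "p \<in> fst d" "p \<in> fst a"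
  shows "\<exists>N. open N \<and> snd c p \<in> N \<and> N \<subseteq> snd c ` (fst c \<inter> fst d) \<and> smooth_on N (transition c d)"
proof -
  define U where "U = snd c ` (fst c \<inter> fst a)"
  define W where "W = snd a ` (fst a \<inter> fst d)"
  \<comment> \<open>The coordinates in \<open>c\<close> of the points common to all three domains,
    written as a preimage so that openness follows from continuity.\<close>
  define N where "N = U \<inter> transition c a -` W"
  have U: "open U" "smooth_on U (transition c a)" and W: "open W" "smooth_on W (transition a d)"
    using assms(3,4) by (simp_all add: compatible_def U_def W_def Int_commute)
  have N: "open N"
    unfolding N_def using continuous_open_preimage[OF smooth_on_continuous[OF U(2)] U(1) W(1)] .
  have q: "\<exists>q\<in>fst c \<inter> fst a \<inter> fst d. z = snd c q" if "z \<in> N" for z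
  proof -
    from that obtain q q' where q: "q \<in> fst c \<inter> fst a" "z = snd c q"
        "q' \<in> fst a \<inter> fst d" "transition c a z = snd a q'"
      by (auto simp: N_def U_def W_def)
    then have "snd a q = snd a q'"
      using transition_apply[OF assms(1), of q a] by simp
    then have "q = q'"
      using q assms(2) by (auto simp: is_chart_def dest: inj_onD)
    then show ?thesis
      using q by blast
  qed
  have "smooth_on N (\<lambda>z. transition a d (transition c a z))"
    by (rule smooth_on_compose[OF W(2) smooth_on_subset[OF U(2)] N]) (auto simp: N_def)
  then have "smooth_on N (transition c d)"
  proof (rule smooth_on_cong[OF _ N])
    show "transition a d (transition c a z) = transition c d z" if "z \<in> N" for z
      using q[OF that] by (auto simp: transition_apply[OF assms(1)] transition_apply[OF assms(2)])
  qed
  moreover have "snd c p \<in> N"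
    using assms by (simp add: transition_apply[OF assms(1,5)] N_def U_def W_def)
  moreover have "N \<subseteq> snd c ` (fst c \<inter> fst d)"
    using q by blast
  ultimately show ?thesis
    using N by blast
qed

lemma comps_add [simp]: "comps (v + w) c = comps v c + comps w c"
  and comps_scaleR [simp]: "comps (r *\<^sub>R v) c = r *\<^sub>R comps v c"
  and comps_diff [simp]: "comps (v - w) c = comps v c - comps w c"
  and comps_zero [simp]: "comps 0 c = 0"
  by (simp_all add: plus_tvec_def scaleR_tvec_def zero_tvec_def minus_tvec_def)

lemma comps_sum [simp]: "comps (\<Sum>i\<in>I. v i) c = (\<Sum>i\<in>I. comps (v i) c)"
  by (induction I rule: infinite_finite_induct) auto

context
  fixes A :: "('m, 'e::euclidean_space) chart set"
  assumes A: "smooth_atlas A"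
begin

lemma atlas_subset_charts: "A \<subseteq> charts A"
  using A by (auto simp: charts_def smooth_atlas_def carrier_def)

lemma carrier_chartE:
  assumes "p \<in> carrier A"
  obtains c where "c \<in> charts A" "p \<in> fst c"
  using assms atlas_subset_charts unfolding carrier_def by blast

lemma chartD: "c \<in> charts A \<Longrightarrow> is_chart c" "c \<in> charts A \<Longrightarrow> p \<in> fst c \<Longrightarrow> p \<in> carrier A"
  by (auto simp: charts_def)

lemma chart_open: "c \<in> charts A \<Longrightarrow> open (snd c ` fst c)"
  by (simp add: charts_def is_chart_def)

text \<open>Membership in \<open>charts A\<close> only asks for compatibility with the given atlas.
  Around each point of an overlap some atlas chart \<open>a\<close> is available, the transition
  factors through it there, and locality glues the results.\<close>

lemma charts_compatible:
  assumes "c \<in> charts A" "d \<in> charts A"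
  shows "compatible c d"
proof -
  have half: "open (snd c ` (fst c \<inter> fst d)) \<and> smooth_on (snd c ` (fst c \<inter> fst d)) (transition c d)"
    if cd: "c \<in> charts A" "d \<in> charts A" for c d
  proof -
    have *: "\<exists>N. open N \<and> z \<in> N \<and> N \<subseteq> snd c ` (fst c \<inter> fst d) \<and> smooth_on N (transition c d)"
      if "z \<in> snd c ` (fst c \<inter> fst d)" for z
    proof -
      from that obtain p where p: "p \<in> fst c" "p \<in> fst d" "z = snd c p"
        by blast
      then obtain a where "a \<in> A" "p \<in> fst a"
        using chartD(2)[OF cd(1), of p] unfolding carrier_def by blast
      then show ?thesis
        using compatible_through[of c a d p] p cd atlas_subset_charts by (auto simp: charts_def)
    qed
    show ?thesis
    proof
      show "open (snd c ` (fst c \<inter> fst d))"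
        using * openI openE open_subset by (metis (no_types, lifting) open_subopen)
      show "smooth_on (snd c ` (fst c \<inter> fst d)) (transition c d)"
        by (rule smooth_on_local) (use * in blast)
    qed
  qed
  show ?thesis
    using half[OF assms] half[OF assms(2,1)] by (simp add: compatible_def Int_commute)
qed

lemma
  assumes "c \<in> charts A" "d \<in> charts A"
  shows open_overlap: "open (snd c ` (fst c \<inter> fst d))"
    and smooth_transition: "smooth_on (snd c ` (fst c \<inter> fst d)) (transition c d)"
  using charts_compatible[OF assms] by (simp_all add: compatible_def)

lemma
  assumes "c \<in> charts A" "d \<in> charts A" "p \<in> fst c" "p \<in> fst d"
  shows has_derivative_transition: "(transition c d has_derivative jacobian c d p) (at (snd c p))"
    and linear_jacobian: "linear (jacobian c d p)"
proof -
  have "transition c d differentiable (at (snd c p))"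
    using smooth_on_differentiable[OF smooth_transition[OF assms(1,2)]] assms by blast
  then show "(transition c d has_derivative jacobian c d p) (at (snd c p))" "linear (jacobian c d p)"
    by (auto intro: has_derivative_frechet_derivative linear_frechet_derivative)
qed

text \<open>The cocycle identity: on the triple overlap, which is open, the transitions compose, and
  the chain rule differentiates this.\<close>

lemma jacobian_compose:
  assumes "c \<in> charts A" "d \<in> charts A" "e \<in> charts A" "p \<in> fst c" "p \<in> fst d" "p \<in> fst e"
  shows "jacobian d e p (jacobian c d p b) = jacobian c e p b"
proof -
  let ?U = "snd c ` (fst c \<inter> fst d \<inter> fst e)"
  have U: "open ?U" "snd c p \<in> ?U"
    using chart_image_Int[OF chartD(1)[OF assms(1)], of "fst d" "fst e"] assms
    by (auto intro!: open_Int[OF open_overlap[OF assms(1,2)] open_overlap[OF assms(1,3)]])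
  have "((\<lambda>z. transition d e (transition c d z)) has_derivative (\<lambda>b. jacobian d e p (jacobian c d p b)))
      (at (snd c p))"
  proof (rule has_derivative_compose[where f = "transition c d" and g = "transition d e"
        and f' = "jacobian c d p" and g' = "jacobian d e p"])
    show "(transition c d has_derivative jacobian c d p) (at (snd c p))"
      using assms by (intro has_derivative_transition)
    show "(transition d e has_derivative jacobian d e p) (at (transition c d (snd c p)))"
      using has_derivative_transition[of d e p] assms by (simp add: transition_apply[OF chartD(1)])
  qed
  then have "(transition c e has_derivative (\<lambda>b. jacobian d e p (jacobian c d p b))) (at (snd c p))"
    by (rule has_derivative_transform_within_open[OF _ U])
      (use assms in \<open>auto simp: transition_apply[OF chartD(1)]\<close>)
  then show ?thesis
    using frechet_derivative_eqI by metis
qed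

lemma jacobian_self:
  assumes "c \<in> charts A" "p \<in> fst c"
  shows "jacobian c c p b = b"
proof -
  have "((\<lambda>z. z) has_derivative (\<lambda>b. b)) (at (snd c p))"
    by simp
  then have "(transition c c has_derivative (\<lambda>b. b)) (at (snd c p))"
    by (rule has_derivative_transform_within_open[of _ _ _ _ "snd c ` fst c"])
      (use assms in \<open>auto simp: transition_apply[OF chartD(1)] chart_open\<close>)
  then show ?thesis
    using frechet_derivative_eqI by metis
qed

lemma comps_coord_vec:
  "d \<in> charts A \<Longrightarrow> p \<in> fst d \<Longrightarrow> comps (coord_vec A c b p) d = jacobian c d p b"
  by (simp add: coord_vec_def)

lemma comps_coord_vec_self:
  "c \<in> charts A \<Longrightarrow> p \<in> fst c \<Longrightarrow> comps (coord_vec A c b p) c = b"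
  by (simp add: comps_coord_vec jacobian_self)

lemma tangent_spaceI:
  assumes "\<And>c d. c \<in> charts A \<Longrightarrow> d \<in> charts A \<Longrightarrow> p \<in> fst c \<Longrightarrow> p \<in> fst d \<Longrightarrow>
      comps v d = jacobian c d p (comps v c)"
    and "\<And>c. \<not> (c \<in> charts A \<and> p \<in> fst c) \<Longrightarrow> comps v c = 0"
  shows "v \<in> tangent_space A p"
  unfolding tangent_space_def using assms by blast

lemma tangent_space_outside:
  "v \<in> tangent_space A p \<Longrightarrow> \<not> (c \<in> charts A \<and> p \<in> fst c) \<Longrightarrow> comps v c = 0"
  unfolding tangent_space_def by blast

text \<open>For the family of components of a coordinate vector, the transformation law is exactly
  the cocycle identity.\<close>

lemma coord_vec_in_tangent_space:
  "c \<in> charts A \<Longrightarrow> p \<in> fst c \<Longrightarrow> coord_vec A c b p \<in> tangent_space A p"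
  by (rule tangent_spaceI) (simp_all add: comps_coord_vec jacobian_compose, auto simp: coord_vec_def)

lemma comps_change:
  "v \<in> tangent_space A p \<Longrightarrow> c \<in> charts A \<Longrightarrow> d \<in> charts A \<Longrightarrow> p \<in> fst c \<Longrightarrow> p \<in> fst d \<Longrightarrow>
    comps v d = jacobian c d p (comps v c)"
  unfolding tangent_space_def by blast

text \<open>The transformation law recovers the components in every other chart around
  \<open>p\<close>, and all remaining components are zero by convention. Hence most identities
  between vectors can be checked in the most convenient chart.\<close>

lemma tangent_eqI:
  assumes "v \<in> tangent_space A p" "w \<in> tangent_space A p" "c \<in> charts A" "p \<in> fst c"
    "comps v c = comps w c"
  shows "v = w"
proof (rule tvec.expand, rule ext)
  fix d
  show "comps v d = comps w d"
  proof (cases "d \<in> charts A \<and> p \<in> fst d")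
    case True
    then show ?thesis
      using assms comps_change by metis
  next
    case False
    then show ?thesis
      using assms(1,2) tangent_space_outside by metis
  qed
qed

lemma tangent_eq_coord_vec:
  assumes "v \<in> tangent_space A p" "c \<in> charts A" "p \<in> fst c"
  shows "v = coord_vec A c (comps v c) p"
  by (rule tangent_eqI[OF assms(1) _ assms(2,3)])
    (simp_all add: coord_vec_in_tangent_space comps_coord_vec_self assms)

lemma coord_vec_change:
  assumes "c \<in> charts A" "d \<in> charts A" "p \<in> fst c" "p \<in> fst d"
  shows "coord_vec A c b p = coord_vec A d (jacobian c d p b) p"
  using tangent_eq_coord_vec[OF coord_vec_in_tangent_space] comps_coord_vec assms by metis

lemma subspace_tangent_space: "subspace (tangent_space A p)"
proof (rule subspaceI)
  show "0 \<in> tangent_space A p"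
    by (rule tangent_spaceI) (simp_all add: linear_0[OF linear_jacobian])
next
  fix v w assume vw: "v \<in> tangent_space A p" "w \<in> tangent_space A p"
  show "v + w \<in> tangent_space A p"
    by (rule tangent_spaceI)
      (simp_all add: linear_add[OF linear_jacobian] comps_change[OF vw(1), symmetric]
        comps_change[OF vw(2), symmetric] tangent_space_outside[OF vw(1)] tangent_space_outside[OF vw(2)])
next
  fix r v assume v: "v \<in> tangent_space A p"
  show "r *\<^sub>R v \<in> tangent_space A p"
    by (rule tangent_spaceI)
      (simp_all add: linear_scale[OF linear_jacobian] comps_change[OF v, symmetric]
        tangent_space_outside[OF v])
qed

lemma coord_vec_linear:
  assumes "c \<in> charts A" "p \<in> fst c"
  shows "linear (\<lambda>b. coord_vec A c b p)"
proof (rule linearI)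
  note sub = subspace_add[OF subspace_tangent_space] subspace_scale[OF subspace_tangent_space]
  show "coord_vec A c (b + b') p = coord_vec A c b p + coord_vec A c b' p" for b b'
    by (rule tangent_eqI[OF _ _ assms])
      (use assms in \<open>simp_all add: sub coord_vec_in_tangent_space comps_coord_vec_self\<close>)
  show "coord_vec A c (r *\<^sub>R b) p = r *\<^sub>R coord_vec A c b p" for r b
    by (rule tangent_eqI[OF _ _ assms])
      (use assms in \<open>simp_all add: sub coord_vec_in_tangent_space comps_coord_vec_self\<close>)
qed

lemma rep_change:
  assumes "\<And>p. p \<in> carrier A \<Longrightarrow> X p \<in> tangent_space A p" "c \<in> charts A" "d \<in> charts A"
    "p \<in> fst c" "p \<in> fst d"
  shows "rep d X (snd d p) = jacobian c d p (rep c X (snd c p))"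
  using comps_change[OF assms(1) assms(2,3)] chartD assms by (simp add: inv_into_chart)

text \<open>The transformation law seen from the target chart \<open>d\<close>: the Jacobian is
  evaluated at the point carried back to \<open>c\<close>, so it is a composite of smooth
  maps.\<close>

lemma smooth_push_forward:
  assumes "c \<in> charts A" "d \<in> charts A" "smooth_on (snd d ` (fst c \<inter> fst d)) w"
  shows "smooth_on (snd d ` (fst c \<inter> fst d))
    (\<lambda>z. frechet_derivative (transition c d) (at (transition d c z)) (w z))"
proof (rule smooth_on_frechet_apply[OF smooth_transition[OF assms(1,2)] _ assms(3)])
  show "smooth_on (snd d ` (fst c \<inter> fst d)) (transition d c)" "open (snd d ` (fst c \<inter> fst d))"
    using smooth_transition[OF assms(2,1)] open_overlap[OF assms(2,1)] by (simp_all add: Int_commute)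
  show "transition d c z \<in> snd c ` (fst c \<inter> fst d)" if "z \<in> snd d ` (fst c \<inter> fst d)" for z
    using that by (auto simp: transition_apply[OF chartD(1)[OF assms(2)]])
qed

text \<open>The definition asks for smoothness in all charts of the maximal atlas. On an overlap the
  representative in \<open>d\<close> is the push-forward of the one in \<open>c\<close>, so one
  suitable chart around each point is enough.\<close>

lemma vector_fieldI:
  assumes tan: "\<And>p. p \<in> carrier A \<Longrightarrow> X p \<in> tangent_space A p"
    and smooth: "\<And>p. p \<in> carrier A \<Longrightarrow> \<exists>c\<in>charts A. p \<in> fst c \<and> smooth_on (snd c ` fst c) (rep c X)"
  shows "vector_field A X"
  unfolding vector_field_def
proof (intro conjI ballI tan)
  fix d assume d: "d \<in> charts A"
  show "smooth_on (snd d ` fst d) (rep d X)"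
  proof (rule smooth_on_local)
    fix z assume "z \<in> snd d ` fst d"
    then obtain p where p: "p \<in> fst d" "z = snd d p"
      by blast
    then obtain c where c: "c \<in> charts A" "p \<in> fst c" "smooth_on (snd c ` fst c) (rep c X)"
      using smooth[of p] chartD d by blast
    let ?U = "snd d ` (fst c \<inter> fst d)"
    have U: "open ?U"
      using open_overlap[OF d c(1)] by (simp add: Int_commute)
    have "smooth_on ?U (transition d c)"
      using smooth_transition[OF d c(1)] by (simp add: Int_commute)
    then have "smooth_on ?U (\<lambda>z. rep c X (transition d c z))"
      by (rule smooth_on_compose[OF c(3) _ U]) (auto simp: transition_apply[OF chartD(1)[OF d]])
    then have "smooth_on ?U (\<lambda>z. frechet_derivative (transition c d) (at (transition d c z))
        (rep c X (transition d c z)))"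
      by (rule smooth_push_forward[OF c(1) d])
    then have "smooth_on ?U (rep d X)"
    proof (rule smooth_on_cong[OF _ U])
      fix z assume "z \<in> ?U"
      then obtain q where "q \<in> fst c" "q \<in> fst d" "z = snd d q"
        by blast
      then show "frechet_derivative (transition c d) (at (transition d c z)) (rep c X (transition d c z)) =
          rep d X z"
        using rep_change[OF tan c(1) d, of q] by (simp add: transition_apply[OF chartD(1)[OF d]])
    qed
    then show "\<exists>T. open T \<and> z \<in> T \<and> smooth_on T (rep d X)"
      using U p c by blast
  qed
qed

text \<open>Smoothness of the factor is asked in one chart around each point; for the pull-back of a
  function on the base, natural charts serve.\<close>

lemma vector_field_scaleR:
  assumes "vector_field A X"
    and "\<And>p. p \<in> carrier A \<Longrightarrow>
      \<exists>c\<in>charts A. p \<in> fst c \<and> smooth_on (snd c ` fst c) (\<lambda>z. g (inv_into (fst c) (snd c) z))"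
  shows "vector_field A (\<lambda>p. g p *\<^sub>R X p)"
proof (rule vector_fieldI)
  show "g p *\<^sub>R X p \<in> tangent_space A p" if "p \<in> carrier A" for p
    using assms(1) that subspace_scale[OF subspace_tangent_space] by (simp add: vector_field_def)
  show "\<exists>c\<in>charts A. p \<in> fst c \<and> smooth_on (snd c ` fst c) (rep c (\<lambda>p. g p *\<^sub>R X p))"
    if "p \<in> carrier A" for p
    using assms(2)[OF that] assms(1) chart_open
    by (auto simp: vector_field_def intro!: bexI smooth_on_scaleR)
qed

text \<open>Differentiating the transformation law of a field adds a second derivative of the
  transition to the expected term. In the bracket these extra terms are \<open>H\<close> at (Y, X)
  and \<open>H\<close> at (X, Y), which cancel by symmetry.\<close>

lemma lie_bracket_in_tangent_space:
  assumes X: "vector_field A X" and Y: "vector_field A Y"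
  shows "lie_bracket A X Y p \<in> tangent_space A p"
  unfolding tangent_space_def
proof (intro CollectI conjI ballI allI impI)
  fix c assume "\<not> (c \<in> charts A \<and> p \<in> fst c)"
  then show "comps (lie_bracket A X Y p) c = 0"
    by (auto simp: lie_bracket_def)
next
  fix c d assume cd: "c \<in> charts A" "d \<in> charts A" "p \<in> fst c \<inter> fst d"
  then have p: "p \<in> fst c" "p \<in> fst d" "p \<in> carrier A"
    using chartD by auto
  let ?U = "snd c ` (fst c \<inter> fst d)" and ?u = "snd c p"
  have U: "open ?U" "?u \<in> ?U"
    using open_overlap cd by auto
  define D where "D Z = frechet_derivative (rep c Z) (at ?u)" for Z
  define H where "H a b = frechet_derivative (\<lambda>y. frechet_derivative (transition c d) (at y) a) (at ?u) b"
    for a b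
  \<comment> \<open>Two derivatives of the same map are compared: the composite
    \<open>rep d Z\<close> after the transition, and the Jacobian applied to
    \<open>rep c Z\<close>.\<close>
  have push: "frechet_derivative (rep d Z) (at (snd d p)) (jacobian c d p b) =
      jacobian c d p (D Z b) + H (comps (Z p) c) b" if Z: "vector_field A Z" for Z b
  proof -
    have diff: "rep a Z differentiable (at (snd a p))" if "a \<in> charts A" "p \<in> fst a" for a
      using smooth_on_differentiable[of "snd a ` fst a" "rep a Z"] Z that by (auto simp: vector_field_def)
    have D1: "((\<lambda>z. rep d Z (transition c d z)) has_derivative
        (\<lambda>b. frechet_derivative (rep d Z) (at (snd d p)) (jacobian c d p b))) (at ?u)"
    proof (rule has_derivative_compose[where f = "transition c d" and g = "rep d Z"
          and f' = "jacobian c d p" and g' = "frechet_derivative (rep d Z) (at (snd d p))"])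
      show "(transition c d has_derivative jacobian c d p) (at ?u)"
        using cd by (intro has_derivative_transition) auto
      show "(rep d Z has_derivative frechet_derivative (rep d Z) (at (snd d p))) (at (transition c d ?u))"
        using has_derivative_frechet_derivative[OF diff[OF cd(2) p(2)]] transition_apply[OF chartD(1)[OF cd(1)] p(1), of d] by simp
    qed
    have "((\<lambda>z. frechet_derivative (transition c d) (at z) (rep c Z z)) has_derivative
        (\<lambda>b. jacobian c d p (D Z b) + H (rep c Z ?u) b)) (at ?u)"
      unfolding H_def D_def
      by (rule has_derivative_frechet_apply[OF smooth_transition[OF cd(1,2)] U
            has_derivative_frechet_derivative[OF diff[OF cd(1) p(1)]]])
    then have D2: "((\<lambda>z. rep d Z (transition c d z)) has_derivative
        (\<lambda>b. jacobian c d p (D Z b) + H (rep c Z ?u) b)) (at ?u)"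
    proof (rule has_derivative_transform_within_open[OF _ U])
      fix z assume "z \<in> ?U"
      then obtain q where q: "q \<in> fst c" "q \<in> fst d" "z = snd c q"
        by blast
      then show "frechet_derivative (transition c d) (at z) (rep c Z z) = rep d Z (transition c d z)"
        using rep_change[of Z, OF _ cd(1,2) q(1,2)] Z
        by (simp add: vector_field_def transition_apply[OF chartD(1)[OF cd(1)] q(1)])
    qed
    show ?thesis
      using fun_cong[OF has_derivative_unique[OF D1 D2]] inv_into_chart[OF chartD(1)[OF cd(1)] p(1)]
      by simp
  qed
  have sym: "H a b = H b a" for a b
    unfolding H_def by (rule second_derivative_symmetric[OF smooth_transition[OF cd(1,2)] U])
  have change: "comps (Z p) d = jacobian c d p (comps (Z p) c)" if "vector_field A Z" for Z
    using comps_change[of "Z p" p c d] that cd p by (simp add: vector_field_def)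
  have "comps (lie_bracket A X Y p) d =
      jacobian c d p (D Y (comps (X p) c)) - jacobian c d p (D X (comps (Y p) c))"
    using cd p by (simp add: lie_bracket_def change X Y push sym)
  also have "\<dots> = jacobian c d p (D Y (comps (X p) c) - D X (comps (Y p) c))"
    using linear_diff[OF linear_jacobian] cd p by metis
  also have "D Y (comps (X p) c) - D X (comps (Y p) c) = comps (lie_bracket A X Y p) c"
    using cd p by (simp add: lie_bracket_def D_def)
  finally show "comps (lie_bracket A X Y p) d = jacobian c d p (comps (lie_bracket A X Y p) c)" .
qed

section \<open>Tensor fields with constant coefficients J in suitable charts\<close>

context
  fixes T :: "'m \<Rightarrow> ('m, 'e) tvec \<Rightarrow> ('m, 'e) tvec" and J :: "'e \<Rightarrow> 'e"
  assumes J: "linear J"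
    and T: "\<And>p. p \<in> carrier A \<Longrightarrow> \<exists>c\<in>charts A. p \<in> fst c \<and>
      (\<forall>q\<in>fst c. \<forall>w\<in>tangent_space A q. T q w = coord_vec A c (J (comps w c)) q)"
begin

lemma constant_coeff_chartE:
  assumes "p \<in> carrier A"
  obtains c where "c \<in> charts A" "p \<in> fst c"
    "\<And>q w. q \<in> fst c \<Longrightarrow> w \<in> tangent_space A q \<Longrightarrow> T q w = coord_vec A c (J (comps w c)) q"
    "\<And>q w. q \<in> fst c \<Longrightarrow> w \<in> tangent_space A q \<Longrightarrow> comps (T q w) c = J (comps w c)"
proof -
  obtain c where "c \<in> charts A" "p \<in> fst c"
    "\<forall>q\<in>fst c. \<forall>w\<in>tangent_space A q. T q w = coord_vec A c (J (comps w c)) q"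
    using T[OF assms] by blast
  then show ?thesis
    using that[of c] by (simp add: comps_coord_vec_self)
qed

lemma constant_coeff_in_tangent_space:
  assumes "w \<in> tangent_space A p" "p \<in> carrier A"
  shows "T p w \<in> tangent_space A p"
  using constant_coeff_chartE[OF assms(2)] coord_vec_in_tangent_space assms(1) by metis

lemma constant_coeff_linear:
  assumes "p \<in> carrier A" "v \<in> tangent_space A p" "w \<in> tangent_space A p"
  shows "T p (v + w) = T p v + T p w" "T p (r *\<^sub>R v) = r *\<^sub>R T p v"
proof -
  note sub = subspace_add[OF subspace_tangent_space] subspace_scale[OF subspace_tangent_space]
  obtain c where c: "c \<in> charts A" "p \<in> fst c"
    "\<And>q w. q \<in> fst c \<Longrightarrow> w \<in> tangent_space A q \<Longrightarrow> T q w = coord_vec A c (J (comps w c)) q"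
    using constant_coeff_chartE[OF assms(1)] by metis
  note lin = coord_vec_linear[OF c(1,2)]
  show "T p (v + w) = T p v + T p w"
    using assms c(2) by (simp add: c(3) sub linear_add[OF J] linear_add[OF lin])
  show "T p (r *\<^sub>R v) = r *\<^sub>R T p v"
    using assms c(2) by (simp add: c(3) sub linear_scale[OF J] linear_scale[OF lin])
qed

text \<open>In an arbitrary chart \<open>d\<close> the coefficients are J conjugated by the
  Jacobians between \<open>d\<close> and a chart with constant coefficients, hence smooth.\<close>

lemma constant_coeff_tensor_field: "tensor_field A T"
  unfolding tensor_field_def Let_def
proof (intro conjI ballI allI constant_coeff_in_tangent_space constant_coeff_linear)
  fix d b assume d: "d \<in> charts A"
  let ?f = "\<lambda>z. comps (T (inv_into (fst d) (snd d) z) (coord_vec A d b (inv_into (fst d) (snd d) z))) d"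
  show "smooth_on (snd d ` fst d) ?f"
  proof (rule smooth_on_local)
    fix z assume "z \<in> snd d ` fst d"
    then obtain p where p: "p \<in> fst d" "z = snd d p" "p \<in> carrier A"
      using chartD d by blast
    obtain c where c: "c \<in> charts A" "p \<in> fst c"
      "\<And>q w. q \<in> fst c \<Longrightarrow> w \<in> tangent_space A q \<Longrightarrow> T q w = coord_vec A c (J (comps w c)) q"
      using constant_coeff_chartE[OF p(3)] by metis
    let ?U = "snd d ` (fst c \<inter> fst d)"
    have U: "open ?U"
      using open_overlap[OF d c(1)] by (simp add: Int_commute)
    have "smooth_on ?U (\<lambda>z. frechet_derivative (transition d c) (at z) b)"
      using smooth_on_frechet[OF smooth_transition[OF d c(1)]] by (simp add: Int_commute)
    then have "smooth_on ?U (\<lambda>z. frechet_derivative (transition c d) (at (transition d c z))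
        (J (frechet_derivative (transition d c) (at z) b)))"
      by (intro smooth_push_forward[OF c(1) d] smooth_on_linear[OF J] U)
    then have "smooth_on ?U ?f"
    proof (rule smooth_on_cong[OF _ U])
      fix z assume "z \<in> ?U"
      then obtain q where q: "q \<in> fst c" "q \<in> fst d" "z = snd d q"
        by blast
      then show "frechet_derivative (transition c d) (at (transition d c z))
          (J (frechet_derivative (transition d c) (at z) b)) = ?f z"
        using transition_apply[OF chartD(1)[OF d] q(2), of c] inv_into_chart[OF chartD(1)[OF d] q(2)] c(1) d
        by (simp add: c(3) coord_vec_in_tangent_space comps_coord_vec)
    qed
    then show "\<exists>T. open T \<and> z \<in> T \<and> smooth_on T ?f"
      using U p c(2) by blast
  qed
qed

lemma constant_coeff_vector_field:
  assumes "vector_field A X"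
  shows "vector_field A (\<lambda>p. T p (X p))"
proof (rule vector_fieldI)
  show "T p (X p) \<in> tangent_space A p" if "p \<in> carrier A" for p
    using assms that by (simp add: vector_field_def constant_coeff_in_tangent_space)
  fix p assume "p \<in> carrier A"
  then obtain c where c: "c \<in> charts A" "p \<in> fst c"
    "\<And>q w. q \<in> fst c \<Longrightarrow> w \<in> tangent_space A q \<Longrightarrow> comps (T q w) c = J (comps w c)"
    using constant_coeff_chartE by metis
  have "smooth_on (snd c ` fst c) (\<lambda>z. J (rep c X z))"
    using assms c(1) chart_open by (intro smooth_on_linear[OF J]) (auto simp: vector_field_def)
  then have "smooth_on (snd c ` fst c) (rep c (\<lambda>p. T p (X p)))"
  proof (rule smooth_on_cong[OF _ chart_open[OF c(1)]])
    fix z assume "z \<in> snd c ` fst c"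
    then obtain q where q: "q \<in> fst c" "z = snd c q" "q \<in> carrier A"
      using chartD c(1) by blast
    then show "J (rep c X z) = rep c (\<lambda>p. T p (X p)) z"
      using assms inv_into_chart[OF chartD(1)[OF c(1)] q(1)] by (simp add: c(3) vector_field_def)
  qed
  then show "\<exists>c\<in>charts A. p \<in> fst c \<and> smooth_on (snd c ` fst c) (rep c (\<lambda>p. T p (X p)))"
    using c by blast
qed

text \<open>A good chart identifies the tangent space at \<open>p\<close> linearly with the model
  space and \<open>T p\<close> with \<open>J\<close>, so kernel and image are transported.\<close>

lemma constant_coeff_almost_tangent:
  assumes "{b. J b = 0} = range J"
  shows "almost_tangent_structure A T"
  unfolding almost_tangent_structure_def
proof (intro conjI ballI constant_coeff_tensor_field)
  fix p assume "p \<in> carrier A"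
  then obtain c where c: "c \<in> charts A" "p \<in> fst c"
    "\<And>q w. q \<in> fst c \<Longrightarrow> w \<in> tangent_space A q \<Longrightarrow> T q w = coord_vec A c (J (comps w c)) q"
    using constant_coeff_chartE by metis
  note cv = coord_vec_in_tangent_space[OF c(1,2)] comps_coord_vec_self[OF c(1,2)]
  have zero: "coord_vec A c b p = 0 \<longleftrightarrow> b = 0" for b
    using linear_0[OF coord_vec_linear[OF c(1,2)]] cv(2) comps_zero by metis
  show "{v \<in> tangent_space A p. T p v = 0} = T p ` tangent_space A p" (is "?K = ?I")
  proof (intro equalityI subsetI)
    fix v assume "v \<in> ?K"
    then have v: "v \<in> tangent_space A p" "T p v = 0"
      by simp_all
    then have "J (comps v c) = 0"
      by (simp add: c(3)[OF c(2)] zero)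
    then obtain b where "comps v c = J b"
      using assms by blast
    then have "v = T p (coord_vec A c b p)"
      using tangent_eq_coord_vec[OF v(1) c(1,2)] by (simp add: c(3)[OF c(2)] cv)
    then show "v \<in> ?I"
      using cv by blast
  next
    fix v assume "v \<in> ?I"
    then obtain w where w: "w \<in> tangent_space A p" "v = T p w"
      by blast
    then have "v = coord_vec A c (J (comps w c)) p"
      by (simp add: c(3)[OF c(2)])
    moreover have "J (J (comps w c)) = 0"
      using assms by blast
    ultimately show "v \<in> ?K"
      by (simp add: c(3)[OF c(2)] cv zero)
  qed
qed

text \<open>Since J is constant, it commutes with differentiating representatives. The terms J DY(J
  X) and J DX(J Y) each occur twice with opposite signs, and what remains is J J applied to DX(Y) -
  DY(X).\<close>

lemma constant_coeff_integrable:
  assumes "\<And>b. J (J b) = 0"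
  shows "integrable_structure A T"
  unfolding integrable_structure_def
proof (intro allI impI ballI, elim conjE)
  fix X Y p assume X: "vector_field A X" and Y: "vector_field A Y" and p: "p \<in> carrier A"
  obtain c where c: "c \<in> charts A" "p \<in> fst c"
    "\<And>q w. q \<in> fst c \<Longrightarrow> w \<in> tangent_space A q \<Longrightarrow> comps (T q w) c = J (comps w c)"
    using constant_coeff_chartE[OF p] by metis
  note TX = constant_coeff_vector_field[OF X] and TY = constant_coeff_vector_field[OF Y]
  note sub = subspace_diff[OF subspace_tangent_space]
  note brackets = lie_bracket_in_tangent_space[OF TX TY] lie_bracket_in_tangent_space[OF TX Y]
    lie_bracket_in_tangent_space[OF X TY]
  let ?u = "snd c p"
  have D: "frechet_derivative (rep c (\<lambda>p. T p (Z p))) (at ?u) b = J (frechet_derivative (rep c Z) (at ?u) b)"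
    if Z: "vector_field A Z" for Z b
  proof -
    have "rep c Z differentiable (at ?u)"
      using smooth_on_differentiable[of "snd c ` fst c" "rep c Z"] Z c by (auto simp: vector_field_def)
    then have "((\<lambda>z. J (rep c Z z)) has_derivative (\<lambda>b. J (frechet_derivative (rep c Z) (at ?u) b))) (at ?u)"
      by (intro bounded_linear.has_derivative[OF linear_conv_bounded_linear[THEN iffD1, OF J]] has_derivative_frechet_derivative)
    then have "(rep c (\<lambda>p. T p (Z p)) has_derivative
        (\<lambda>b. J (frechet_derivative (rep c Z) (at ?u) b))) (at ?u)"
    proof (rule has_derivative_transform_within_open[of _ _ _ _ "snd c ` fst c"])
      show "open (snd c ` fst c)" "?u \<in> snd c ` fst c"
        using chart_open c by auto
      fix z assume "z \<in> snd c ` fst c"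
      then obtain q where q: "q \<in> fst c" "z = snd c q" "q \<in> carrier A"
        using chartD c(1) by blast
      then show "J (rep c Z z) = rep c (\<lambda>p. T p (Z p)) z"
        using Z inv_into_chart[OF chartD(1)[OF c(1)] q(1)] by (simp add: c(3) vector_field_def)
    qed
    then show ?thesis
      by (simp add: frechet_derivative_eqI)
  qed
  have bracket: "comps (lie_bracket A V W p) c =
      frechet_derivative (rep c W) (at ?u) (comps (V p) c) - frechet_derivative (rep c V) (at ?u) (comps (W p) c)"
    for V W
    using c by (simp add: lie_bracket_def)
  have XY: "X p \<in> tangent_space A p" "Y p \<in> tangent_space A p"
    using X Y p by (auto simp: vector_field_def)
  have "comps (nijenhuis A T X Y p) c = 0"
    unfolding nijenhuis_def
    using c(2) XY
    by (simp add: c(3) brackets bracket D X Y linear_diff[OF J] assms)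
  \<comment> \<open>Vanishing components in the one chart \<open>c\<close> suffice only for an
    actual tangent vector; this is where the chart independence of the three brackets
    enters.\<close>
  moreover have "nijenhuis A T X Y p \<in> tangent_space A p"
    unfolding nijenhuis_def by (intro sub brackets constant_coeff_in_tangent_space p)
  ultimately show "nijenhuis A T X Y p = 0"
    by (intro tangent_eqI[OF _ subspace_0[OF subspace_tangent_space] c(1,2)]) simp_all
qed

end

end

section \<open>Scaled charts of the tangent bundle\<close>

lemma scaled_chart_simps [simp]:
  "y \<in> fst (scaled_chart Q g c) \<longleftrightarrow> fst y \<in> fst c \<and> snd y \<in> tangent_space Q (fst y)"
  "snd (scaled_chart Q g c) y = (snd c (fst y), g (fst y) *\<^sub>R comps (snd y) c)"
  by (auto simp: scaled_chart_def split_beta)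

lemma smooth_function_chart:
  "smooth_function Q g \<Longrightarrow> c \<in> charts Q \<Longrightarrow>
    smooth_on (snd c ` fst c) (\<lambda>x. g (inv_into (fst c) (snd c) x))"
  unfolding smooth_function_def by (simp add: o_def)

lemma smooth_function_const: "smooth_function Q (\<lambda>_. r)"
  by (simp add: smooth_function_def o_def smooth_on_const)

lemma scaled_chart_Int:
  "fst (scaled_chart Q g c) \<inter> fst (scaled_chart Q h c') = {y \<in> fst (scaled_chart Q g c). fst y \<in> fst c'}"
  by auto

lemma sum_axis: "(\<Sum>i\<in>UNIV. (x $ i) *\<^sub>R axis i 1) = (x :: real^'k::finite)"
  using basis_expansion[of x] by (simp add: scalar_mult_eq_scaleR)

context
  fixes Q :: "('q, real^'n::finite) chart set"
  assumes Q: "smooth_atlas Q"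
begin

text \<open>Because \<open>g\<close> does not vanish, every fibre is mapped onto the whole model
  space. The set \<open>U\<close> is left free: it will be everything, the domain of a second base
  chart, or the base of an adapted chart.\<close>

lemma scaled_chart_image:
  assumes c: "c \<in> charts Q" and g: "\<forall>q\<in>carrier Q. g q \<noteq> 0"
  shows "snd (scaled_chart Q g c) ` {y \<in> fst (scaled_chart Q g c). fst y \<in> U} = snd c ` (fst c \<inter> U) \<times> UNIV"
    (is "?L = ?R")
proof (intro equalityI subsetI)
  fix z assume "z \<in> ?L"
  then show "z \<in> ?R"
    by auto
next
  fix z assume "z \<in> ?R"
  then obtain q v where q: "q \<in> fst c" "q \<in> U" "z = (snd c q, v)"
    by auto
  \<comment> \<open>Dividing by \<open>g q\<close> compensates the factor that the scaled chart
    applies.\<close>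
  let ?y = "(q, coord_vec Q c (v /\<^sub>R g q) q)"
  have "g q \<noteq> 0"
    using g chartD(2)[OF Q c q(1)] by simp
  then have "z = snd (scaled_chart Q g c) ?y"
    using q(3) by (simp add: comps_coord_vec_self[OF Q c q(1)])
  moreover have "?y \<in> {y \<in> fst (scaled_chart Q g c). fst y \<in> U}"
    using q coord_vec_in_tangent_space[OF Q c q(1)] by simp
  ultimately show "z \<in> ?L"
    by blast
qed

lemma is_chart_scaled_chart:
  assumes c: "c \<in> charts Q" and g: "\<forall>q\<in>carrier Q. g q \<noteq> 0"
  shows "is_chart (scaled_chart Q g c)"
  unfolding is_chart_def
proof
  show "inj_on (snd (scaled_chart Q g c)) (fst (scaled_chart Q g c))"
  proof (rule inj_onI)
    fix y y' assume y: "y \<in> fst (scaled_chart Q g c)" "y' \<in> fst (scaled_chart Q g c)"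
      and eq: "snd (scaled_chart Q g c) y = snd (scaled_chart Q g c) y'"
    then have q: "fst y' = fst y"
      using chartD(1)[OF Q c] by (auto simp: is_chart_def dest: inj_onD)
    moreover have "g (fst y) \<noteq> 0"
      using g chartD(2)[OF Q c] y by simp
    ultimately have "snd y = snd y'"
      using y eq by (intro tangent_eqI[OF Q _ _ c]) auto
    with q show "y = y'"
      by (simp add: prod_eq_iff)
  qed
  have "snd (scaled_chart Q g c) ` fst (scaled_chart Q g c) = snd c ` fst c \<times> UNIV"
    using scaled_chart_image[OF c g, of UNIV] by (simp del: scaled_chart_simps)
  then show "open (snd (scaled_chart Q g c) ` fst (scaled_chart Q g c))"
    using chart_open[OF Q c] by (simp add: open_Times)
qed

text \<open>The fibre coordinate is divided by \<open>g\<close>, moved by the Jacobian of the base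
  and multiplied by \<open>h\<close>. With g = h = 1 this is the usual change of natural
  coordinates.\<close>

lemma transition_scaled_chart:
  assumes c: "c \<in> charts Q" and c': "c' \<in> charts Q" and g: "\<forall>q\<in>carrier Q. g q \<noteq> 0"
    and q: "q \<in> fst c" "q \<in> fst c'"
  shows "transition (scaled_chart Q g c) (scaled_chart Q h c') (snd c q, v) =
    (snd c' q, (h q / g q) *\<^sub>R jacobian c c' q v)"
proof -
  let ?y = "(q, coord_vec Q c (v /\<^sub>R g q) q)"
  have "g q \<noteq> 0"
    using g chartD(2)[OF Q c q(1)] by simp
  then have eq: "(snd c q, v) = snd (scaled_chart Q g c) ?y"
    by (simp add: comps_coord_vec_self[OF Q c q(1)])
  have y: "?y \<in> fst (scaled_chart Q g c)"
    using q coord_vec_in_tangent_space[OF Q c q(1)] by simp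
  have "transition (scaled_chart Q g c) (scaled_chart Q h c') (snd c q, v) = snd (scaled_chart Q h c') ?y"
    unfolding eq by (rule transition_apply[OF is_chart_scaled_chart[OF c g] y])
  also have "\<dots> = (snd c' q, (h q / g q) *\<^sub>R jacobian c c' q v)"
    using linear_scale[OF linear_jacobian[OF Q c c' q], of "inverse (g q)" v]
    by (simp add: comps_coord_vec[OF Q c' q(2)] divide_inverse)
  finally show ?thesis .
qed

lemma scaled_chart_overlap:
  assumes c: "c \<in> charts Q" and c': "c' \<in> charts Q" and g: "\<forall>q\<in>carrier Q. g q \<noteq> 0"
  shows "snd (scaled_chart Q g c) ` (fst (scaled_chart Q g c) \<inter> fst (scaled_chart Q h c')) =
      snd c ` (fst c \<inter> fst c') \<times> UNIV"
    and "open (snd c ` (fst c \<inter> fst c') \<times> (UNIV :: (real^'n) set))"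
  unfolding scaled_chart_Int
  using scaled_chart_image[OF c g] open_overlap[OF Q c c'] by (simp_all add: open_Times)

lemma smooth_transition_scaled_chart:
  assumes c: "c \<in> charts Q" and c': "c' \<in> charts Q"
    and g: "smooth_function Q g" "\<forall>q\<in>carrier Q. g q \<noteq> 0" and h: "smooth_function Q h"
  shows "smooth_on (snd c ` (fst c \<inter> fst c') \<times> UNIV) (transition (scaled_chart Q g c) (scaled_chart Q h c'))"
proof -
  let ?V = "snd c ` (fst c \<inter> fst c')"
  let ?W = "?V \<times> (UNIV :: (real^'n) set)"
  let ?i = "inv_into (fst c) (snd c)"
  have W: "open ?W"
    using scaled_chart_overlap(2)[OF c c'] g(2) by blast
  have fst: "smooth_on ?W fst" and snd: "smooth_on ?W snd"
    using W by (auto intro: smooth_on_fst smooth_on_snd)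
  have base: "smooth_on ?W (\<lambda>z. k (fst z))"
    if "smooth_on (snd c ` (fst c \<inter> fst c')) k" for k :: "real^'n \<Rightarrow> 'b::real_normed_vector"
    by (rule smooth_on_compose[OF that fst W]) auto
  have fn: "smooth_on ?V (\<lambda>x. k (?i x))" if "smooth_function Q k" for k
    by (rule smooth_on_subset[OF smooth_function_chart[OF that c]]) auto
  have nz: "g (?i (fst z)) \<noteq> 0" if "z \<in> ?W" for z
    using that g(2) chartD[OF Q c] inv_into_chart[OF chartD(1)[OF Q c]] by auto
  have "smooth_on ?W (\<lambda>z. (transition c c' (fst z),
      (h (?i (fst z)) * inverse (g (?i (fst z)))) *\<^sub>R frechet_derivative (transition c c') (at (fst z)) (snd z)))"
  proof (intro smooth_on_Pair smooth_on_scaleR smooth_on_mult smooth_on_inverse W)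
    show "smooth_on ?W (\<lambda>z. transition c c' (fst z))"
      by (rule base[OF smooth_transition[OF Q c c']])
    show "smooth_on ?W (\<lambda>z. h (?i (fst z)))" "smooth_on ?W (\<lambda>z. g (?i (fst z)))"
      by (rule base[OF fn[OF h]], rule base[OF fn[OF g(1)]])
    show "smooth_on ?W (\<lambda>z. frechet_derivative (transition c c') (at (fst z)) (snd z))"
      by (rule smooth_on_frechet_apply[OF smooth_transition[OF Q c c'] fst snd W]) auto
  qed (rule nz)
  then show ?thesis
  proof (rule smooth_on_cong[OF _ W])
    fix z assume "z \<in> ?W"
    then obtain q v where q: "q \<in> fst c" "q \<in> fst c'" "z = (snd c q, v)"
      by auto
    show "(transition c c' (fst z), (h (?i (fst z)) * inverse (g (?i (fst z)))) *\<^sub>R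
        frechet_derivative (transition c c') (at (fst z)) (snd z)) =
      transition (scaled_chart Q g c) (scaled_chart Q h c') z"
      unfolding q(3) transition_scaled_chart[OF c c' g(2) q(1,2)]
      using transition_apply[OF chartD(1)[OF Q c] q(1), of c'] inv_into_chart[OF chartD(1)[OF Q c] q(1)]
      by (simp add: divide_inverse)
  qed
qed

lemma compatible_scaled_chart:
  assumes c: "c \<in> charts Q" and c': "c' \<in> charts Q"
    and g: "smooth_function Q g" "\<forall>q\<in>carrier Q. g q \<noteq> 0"
    and h: "smooth_function Q h" "\<forall>q\<in>carrier Q. h q \<noteq> 0"
  shows "compatible (scaled_chart Q g c) (scaled_chart Q h c')"
  using scaled_chart_overlap[OF c c' g(2)] scaled_chart_overlap(1)[OF c c' g(2), of h]
    scaled_chart_overlap[OF c' c h(2)] scaled_chart_overlap(1)[OF c' c h(2), of g]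
    smooth_transition_scaled_chart[OF c c' g h(1)] smooth_transition_scaled_chart[OF c' c h g(1)]
  by (simp add: compatible_def Int_commute del: scaled_chart_simps)

lemma smooth_atlas_tangent_bundle: "smooth_atlas (tangent_bundle Q)"
  unfolding smooth_atlas_def tangent_bundle_def
  by (auto intro!: is_chart_scaled_chart compatible_scaled_chart smooth_function_const)

lemma carrier_tangent_bundle:
  "y \<in> carrier (tangent_bundle Q) \<longleftrightarrow> fst y \<in> carrier Q \<and> snd y \<in> tangent_space Q (fst y)"
proof
  assume "y \<in> carrier (tangent_bundle Q)"
  then obtain c where "c \<in> charts Q" "y \<in> fst (natural_chart Q c)"
    unfolding tangent_bundle_def Defs.carrier_def[of "natural_chart Q ` charts Q"] by blast
  then show "fst y \<in> carrier Q \<and> snd y \<in> tangent_space Q (fst y)"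
    using chartD(2)[OF Q, of c "fst y"] by simp
next
  assume y: "fst y \<in> carrier Q \<and> snd y \<in> tangent_space Q (fst y)"
  then obtain c where "c \<in> charts Q" "fst y \<in> fst c"
    using carrier_chartE[OF Q] by metis
  then have "c \<in> charts Q" "y \<in> fst (natural_chart Q c)"
    using y by simp_all
  then show "y \<in> carrier (tangent_bundle Q)"
    unfolding tangent_bundle_def Defs.carrier_def[of "natural_chart Q ` charts Q"] by blast
qed

lemma bundle_chartE:
  assumes "y \<in> carrier (tangent_bundle Q)"
  obtains c where "c \<in> charts Q" "fst y \<in> fst c" "y \<in> fst (natural_chart Q c)"
  using assms carrier_chartE[OF Q, of "fst y"] scaled_chart_simps(1) carrier_tangent_bundle by metis

lemma scaled_chart_in_charts:
  assumes c: "c \<in> charts Q" and g: "smooth_function Q g" "\<forall>q\<in>carrier Q. g q \<noteq> 0"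
  shows "scaled_chart Q g c \<in> charts (tangent_bundle Q)"
  unfolding charts_def
proof (intro CollectI conjI ballI)
  show "fst (scaled_chart Q g c) \<subseteq> carrier (tangent_bundle Q)"
    using chartD(2)[OF Q c] by (auto simp: carrier_tangent_bundle)
  show "compatible (scaled_chart Q g c) d" if "d \<in> tangent_bundle Q" for d
    using that c g by (auto simp: tangent_bundle_def intro!: compatible_scaled_chart smooth_function_const)
qed (rule is_chart_scaled_chart[OF c g(2)])

lemma natural_chart_in_charts: "c \<in> charts Q \<Longrightarrow> natural_chart Q c \<in> charts (tangent_bundle Q)"
  by (rule scaled_chart_in_charts) (simp_all add: smooth_function_const)

context
  fixes c c' g h y
  assumes c: "c \<in> charts Q" and c': "c' \<in> charts Q"
    and g: "smooth_function Q g" "\<forall>q\<in>carrier Q. g q \<noteq> 0"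
    and h: "smooth_function Q h" "\<forall>q\<in>carrier Q. h q \<noteq> 0"
    and y: "y \<in> carrier (tangent_bundle Q)" "fst y \<in> fst c" "fst y \<in> fst c'"
begin

lemma mem_scaled_charts: "y \<in> fst (scaled_chart Q g c)" "y \<in> fst (scaled_chart Q h c')"
  using y by (simp_all add: carrier_tangent_bundle)

lemma has_derivative_scaled_transition:
  "(transition (scaled_chart Q g c) (scaled_chart Q h c') has_derivative
    jacobian (scaled_chart Q g c) (scaled_chart Q h c') y) (at (snd (scaled_chart Q g c) y))"
  by (rule has_derivative_transition[OF smooth_atlas_tangent_bundle
        scaled_chart_in_charts[OF c g] scaled_chart_in_charts[OF c' h] mem_scaled_charts])

text \<open>The base part of the transition depends on x alone. This expresses the invariance of dx
  under scaling.\<close>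

lemma fst_jacobian_scaled_chart:
  "fst (jacobian (scaled_chart Q g c) (scaled_chart Q h c') y b) = jacobian c c' (fst y) (fst b)"
proof -
  let ?W = "snd c ` (fst c \<inter> fst c') \<times> (UNIV :: (real^'n) set)"
  let ?u = "snd (scaled_chart Q g c) y"
  have W: "open ?W" "?u \<in> ?W"
    using scaled_chart_overlap(2)[OF c c' g(2)] y by auto
  have "((\<lambda>z. fst (transition (scaled_chart Q g c) (scaled_chart Q h c') z)) has_derivative
      (\<lambda>b. fst (jacobian (scaled_chart Q g c) (scaled_chart Q h c') y b))) (at ?u)"
    by (rule has_derivative_fst[OF has_derivative_scaled_transition])
  then have D1: "((\<lambda>z. transition c c' (fst z)) has_derivative
      (\<lambda>b. fst (jacobian (scaled_chart Q g c) (scaled_chart Q h c') y b))) (at ?u)"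
  proof (rule has_derivative_transform_within_open[OF _ W])
    fix z assume "z \<in> ?W"
    then obtain q v where q: "q \<in> fst c" "q \<in> fst c'" "z = (snd c q, v)"
      by auto
    show "fst (transition (scaled_chart Q g c) (scaled_chart Q h c') z) = transition c c' (fst z)"
      unfolding q(3) transition_scaled_chart[OF c c' g(2) q(1,2)]
      using transition_apply[OF chartD(1)[OF Q c] q(1), of c'] by simp
  qed
  have D2: "((\<lambda>z. transition c c' (fst z)) has_derivative (\<lambda>b. jacobian c c' (fst y) (fst b))) (at ?u)"
  proof (rule has_derivative_compose[where f = fst and f' = fst and g = "transition c c'"
        and g' = "jacobian c c' (fst y)"])
    show "(fst has_derivative fst) (at ?u)"
      by (rule bounded_linear_imp_has_derivative[OF bounded_linear_fst])
    show "(transition c c' has_derivative jacobian c c' (fst y)) (at (fst ?u))"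
      using has_derivative_transition[OF Q c c' y(2,3)] by simp
  qed
  show ?thesis
    using fun_cong[OF has_derivative_unique[OF D1 D2]] by simp
qed

text \<open>For fixed x the transition is linear in the fibre coordinate, so differentiating along a
  vertical line gives this block without the derivatives of \<open>g\<close>, \<open>h\<close> or
  the base Jacobian.\<close>

lemma jacobian_scaled_chart_vertical:
  "jacobian (scaled_chart Q g c) (scaled_chart Q h c') y (0, b) =
    (0, (h (fst y) / g (fst y)) *\<^sub>R jacobian c c' (fst y) b)"
proof -
  let ?F = "transition (scaled_chart Q g c) (scaled_chart Q h c')"
  let ?u = "snd (scaled_chart Q g c) y"
  let ?r = "h (fst y) / g (fst y)"
  let ?j = "jacobian c c' (fst y)"
  have "?F differentiable (at (?u + 0 *\<^sub>R (0, b)))"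
    using has_derivative_scaled_transition by (auto simp: differentiable_def)
  from has_vector_derivative_along_line[OF this]
  have D1: "((\<lambda>s. ?F (?u + s *\<^sub>R (0, b))) has_vector_derivative
      jacobian (scaled_chart Q g c) (scaled_chart Q h c') y (0, b)) (at 0)"
    by simp
  have "g (fst y) \<noteq> 0"
    using g(2) y(1) by (simp add: carrier_tangent_bundle)
  then have "?F (?u + s *\<^sub>R (0, b)) = (snd c' (fst y), ?r *\<^sub>R ?j (snd ?u) + s *\<^sub>R ?r *\<^sub>R ?j b)" for s
    using transition_scaled_chart[OF c c' g(2) y(2,3), of h "snd ?u + s *\<^sub>R b"]
      linear_add[OF linear_jacobian[OF Q c c' y(2,3)], of "snd ?u" "s *\<^sub>R b"]
      linear_scale[OF linear_jacobian[OF Q c c' y(2,3)], of s b]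
    by (simp add: scaleR_add_right)
  moreover have "((\<lambda>s. (k, a + s *\<^sub>R a')) has_vector_derivative (0, a')) (at 0)" for k a a' :: "real^'n"
    unfolding has_vector_derivative_def by (auto intro!: derivative_eq_intros)
  from this[of "snd c' (fst y)" "?r *\<^sub>R ?j (snd ?u)" "?r *\<^sub>R ?j b"]
  have "((\<lambda>s. (snd c' (fst y), ?r *\<^sub>R ?j (snd ?u) + s *\<^sub>R ?r *\<^sub>R ?j b)) has_vector_derivative
      (0, ?r *\<^sub>R ?j b)) (at 0)" .
  ultimately have "((\<lambda>s. ?F (?u + s *\<^sub>R (0, b))) has_vector_derivative (0, ?r *\<^sub>R ?j b)) (at 0)"
    by presburger
  then show ?thesis
    using vector_derivative_unique_at[OF D1] by metis
qed

lemma coord_vec_vertical_change: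
  "coord_vec (tangent_bundle Q) (scaled_chart Q g c) (0, b) y =
    coord_vec (tangent_bundle Q) (scaled_chart Q h c')
      (0, (h (fst y) / g (fst y)) *\<^sub>R jacobian c c' (fst y) b) y"
  using coord_vec_change[OF smooth_atlas_tangent_bundle scaled_chart_in_charts[OF c g]
      scaled_chart_in_charts[OF c' h] mem_scaled_charts, of "(0, b)"]
  by (simp only: jacobian_scaled_chart_vertical)

end

text \<open>Turns sums over coordinate fields into one \<open>coord_vec\<close>; afterwards,
  computations happen on pairs in the model space.\<close>

lemma coord_vec_sum_axis:
  assumes d: "d \<in> charts (tangent_bundle Q)" "y \<in> fst d"
  shows "(\<Sum>i\<in>UNIV. (x $ i) *\<^sub>R ddx Q d i y) = coord_vec (tangent_bundle Q) d (x, 0) y"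
    and "(\<Sum>i\<in>UNIV. (x $ i) *\<^sub>R ddu Q d i y) = coord_vec (tangent_bundle Q) d (0, x) y"
proof -
  note lin = coord_vec_linear[OF smooth_atlas_tangent_bundle d]
  have "(\<Sum>i\<in>UNIV. (x $ i) *\<^sub>R coord_vec (tangent_bundle Q) d (L (axis i 1)) y) =
      coord_vec (tangent_bundle Q) d (L x) y" if L: "linear L" for L
    using linear_sum[OF lin, of "\<lambda>i. (x $ i) *\<^sub>R L (axis i 1)" UNIV]
      linear_sum[OF L, of "\<lambda>i. (x $ i) *\<^sub>R axis i 1" UNIV] sum_axis[of x]
    by (simp add: linear_scale[OF lin] linear_scale[OF L])
  from this[of "\<lambda>x. (x, 0)"] this[of "\<lambda>x. (0, x)"]
  show "(\<Sum>i\<in>UNIV. (x $ i) *\<^sub>R ddx Q d i y) = coord_vec (tangent_bundle Q) d (x, 0) y"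
    "(\<Sum>i\<in>UNIV. (x $ i) *\<^sub>R ddu Q d i y) = coord_vec (tangent_bundle Q) d (0, x) y"
    by (simp_all add: ddx_def ddu_def linearI)
qed

lemma chart_tensor_eq:
  "d \<in> charts (tangent_bundle Q) \<Longrightarrow> y \<in> fst d \<Longrightarrow>
    chart_tensor Q d y w = coord_vec (tangent_bundle Q) d (0, fst (comps w d)) y"
  unfolding chart_tensor_def by (rule coord_vec_sum_axis)

lemma chart_liouville_eq:
  "d \<in> charts (tangent_bundle Q) \<Longrightarrow> y \<in> fst d \<Longrightarrow>
    chart_liouville Q d y = coord_vec (tangent_bundle Q) d (0, snd (snd d y)) y"
  unfolding chart_liouville_def by (rule coord_vec_sum_axis)

context
  fixes c c' g h y
  assumes c: "c \<in> charts Q" and c': "c' \<in> charts Q"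
    and g: "smooth_function Q g" "\<forall>q\<in>carrier Q. g q \<noteq> 0"
    and h: "smooth_function Q h" "\<forall>q\<in>carrier Q. h q \<noteq> 0"
    and y: "y \<in> carrier (tangent_bundle Q)" "fst y \<in> fst c" "fst y \<in> fst c'"
begin

text \<open>The factor h / g picked up by the vertical coordinate vectors turns the coefficient g w
  into h times the transformed w. With g = 1 and h = f this gives the equality of the two Liouville
  fields.\<close>

lemma chart_liouville_change:
  "chart_liouville Q (scaled_chart Q g c) y = chart_liouville Q (scaled_chart Q h c') y"
proof -
  have "g (fst y) \<noteq> 0"
    using g(2) y(1) by (simp add: carrier_tangent_bundle)
  moreover have "comps (snd y) c' = jacobian c c' (fst y) (comps (snd y) c)"
    using y comps_change[OF Q _ c c' y(2,3)] by (simp add: carrier_tangent_bundle)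
  moreover note linear_scale[OF linear_jacobian[OF Q c c' y(2,3)], of "g (fst y)" "comps (snd y) c"]
  ultimately show ?thesis
    using coord_vec_vertical_change[OF c c' g h y, of "snd (snd (scaled_chart Q g c) y)"]
    by (simp add: chart_liouville_eq[OF scaled_chart_in_charts[OF c g] mem_scaled_charts(1)[OF c c' g h y]]
        chart_liouville_eq[OF scaled_chart_in_charts[OF c' h] mem_scaled_charts(2)[OF c c' g h y]])
qed

text \<open>The dx part transforms by the base Jacobian only, so the whole effect of rescaling is
  the factor h / g from d/du.\<close>

lemma chart_tensor_change:
  assumes w: "w \<in> tangent_space (tangent_bundle Q) y"
  shows "chart_tensor Q (scaled_chart Q g c) y w =
    (h (fst y) / g (fst y)) *\<^sub>R chart_tensor Q (scaled_chart Q h c') y w"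
proof -
  let ?e = "scaled_chart Q g c" and ?e' = "scaled_chart Q h c'"
  note e = scaled_chart_in_charts[OF c g] mem_scaled_charts(1)[OF c c' g h y]
  note e' = scaled_chart_in_charts[OF c' h] mem_scaled_charts(2)[OF c c' g h y]
  have "fst (comps w ?e') = jacobian c c' (fst y) (fst (comps w ?e))"
    using comps_change[OF smooth_atlas_tangent_bundle w e(1) e'(1) e(2) e'(2)]
      fst_jacobian_scaled_chart[OF c c' g h y] by metis
  then show ?thesis
    using coord_vec_vertical_change[OF c c' g h y, of "fst (comps w ?e)"]
      linear_scale[OF coord_vec_linear[OF smooth_atlas_tangent_bundle e'],
        of "h (fst y) / g (fst y)" "(0, fst (comps w ?e'))"]
    by (simp add: chart_tensor_eq[OF e] chart_tensor_eq[OF e'])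
qed

end

lemma natural_chart_atE:
  assumes "y \<in> carrier (tangent_bundle Q)"
  obtains c where "c \<in> charts Q" "fst y \<in> fst c" "natural_chart_at Q y = natural_chart Q c"
proof -
  have "\<exists>c. c \<in> charts Q \<and> fst y \<in> fst c"
    using bundle_chartE[OF assms] by metis
  from someI_ex[OF this] that show thesis
    unfolding natural_chart_at_def by blast
qed

lemma natural_liouville_eq:
  assumes c: "c \<in> charts Q" and g: "smooth_function Q g" "\<forall>q\<in>carrier Q. g q \<noteq> 0"
    and y: "y \<in> fst (scaled_chart Q g c)"
  shows "natural_liouville Q y = chart_liouville Q (scaled_chart Q g c) y"
proof -
  have y': "y \<in> carrier (tangent_bundle Q)"
    using chartD(2)[OF smooth_atlas_tangent_bundle scaled_chart_in_charts[OF c g] y] .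
  then obtain c' where "c' \<in> charts Q" "fst y \<in> fst c'" "natural_chart_at Q y = natural_chart Q c'"
    by (rule natural_chart_atE)
  then show ?thesis
    unfolding natural_liouville_def
    using chart_liouville_change[OF _ c smooth_function_const _ g y'] y by simp
qed

text \<open>The choice of a natural chart at \<open>y\<close> is harmless, since all of them have
  scaling factor 1; the factor on the right is g / 1.\<close>

lemma natural_structure_eq:
  assumes c: "c \<in> charts Q" and g: "smooth_function Q g" "\<forall>q\<in>carrier Q. g q \<noteq> 0"
    and y: "y \<in> fst (scaled_chart Q g c)" and w: "w \<in> tangent_space (tangent_bundle Q) y"
  shows "natural_structure Q y w = g (fst y) *\<^sub>R chart_tensor Q (scaled_chart Q g c) y w"
proof -
  have y': "y \<in> carrier (tangent_bundle Q)"
    using chartD(2)[OF smooth_atlas_tangent_bundle scaled_chart_in_charts[OF c g] y] .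
  then obtain c' where "c' \<in> charts Q" "fst y \<in> fst c'" "natural_chart_at Q y = natural_chart Q c'"
    by (rule natural_chart_atE)
  then show ?thesis
    unfolding natural_structure_def
    using chart_tensor_change[OF _ c smooth_function_const _ g y' _ _ w] y by simp
qed

end

section \<open>Reparametrization of integral curves\<close>

text \<open>The inverse of \<open>\<tau>\<close> has derivative \<open>g\<close> along the curve, so
  the chain rule multiplies the velocity by \<open>g\<close>. The new curve is prescribed only on
  the image of \<open>I\<close>, hence that image must be shown to be an open interval.\<close>

lemma integral_curve_reparametrize:
  assumes \<gamma>: "integral_curve A X I \<gamma>"
    and \<tau>: "\<And>t. t \<in> I \<Longrightarrow> (\<tau> has_real_derivative 1 / g (\<gamma> t)) (at t)"
    and g: "\<forall>p\<in>carrier A. g p \<noteq> 0"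
  shows "inj_on \<tau> I"
    and "(\<And>t. t \<in> I \<Longrightarrow> \<gamma>' (\<tau> t) = \<gamma> t) \<Longrightarrow> integral_curve A (\<lambda>p. g p *\<^sub>R X p) (\<tau> ` I) \<gamma>'"
proof -
  have I: "open I" "is_interval I" "\<And>t. t \<in> I \<Longrightarrow> \<gamma> t \<in> carrier A"
    and vel: "\<And>t. t \<in> I \<Longrightarrow> has_velocity A \<gamma> (X (\<gamma> t)) t"
    using \<gamma> by (auto simp: integral_curve_def)
  have nz: "g (\<gamma> t) \<noteq> 0" if "t \<in> I" for t
    using I(3)[OF that] g by blast
  \<comment> \<open>By the mean value theorem an increment of \<open>\<tau>\<close> is a nonzero
    length times some 1 / g, which is nonzero whatever its sign.\<close>
  have ne: "\<tau> a \<noteq> \<tau> b" if "a \<in> I" "b \<in> I" "a < b" for a b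
  proof -
    have sub: "t \<in> I" if "a \<le> t" "t \<le> b" for t
      by (rule mem_is_interval_1_I[OF I(2) \<open>a \<in> I\<close> \<open>b \<in> I\<close> that])
    have "\<exists>z>a. z < b \<and> \<tau> b - \<tau> a = (b - a) * (1 / g (\<gamma> z))"
      by (rule MVT2[OF \<open>a < b\<close>]) (rule \<tau>[OF sub])
    then obtain z where "a < z" "z < b" "\<tau> b - \<tau> a = (b - a) * (1 / g (\<gamma> z))"
      by blast
    then show ?thesis
      using nz[OF sub[of z]] by auto
  qed
  show inj: "inj_on \<tau> I"
    by (rule inj_onI) (metis ne linorder_neqE)
  have cont: "continuous_on I \<tau>"
    using \<tau> DERIV_isCont continuous_at_imp_continuous_on by blast
  have op: "open (\<tau> ` N)" if "open N" "N \<subseteq> I" for N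
    using injective_into_1d_imp_open_map_UNIV[OF that(1) cont inj that(2)] .
  show "integral_curve A (\<lambda>p. g p *\<^sub>R X p) (\<tau> ` I) \<gamma>'" if \<gamma>': "\<And>t. t \<in> I \<Longrightarrow> \<gamma>' (\<tau> t) = \<gamma> t"
    unfolding integral_curve_def
  proof (intro conjI ballI)
    show "open (\<tau> ` I)"
      by (rule op[OF I(1) order_refl])
    show "is_interval (\<tau> ` I)"
      using connected_continuous_image[OF cont] I(2) by (simp add: is_interval_connected_1)
  next
    fix s assume "s \<in> \<tau> ` I"
    then obtain t where t: "t \<in> I" "s = \<tau> t"
      by blast
    show "\<gamma>' s \<in> carrier A"
      using t I(3) \<gamma>' by simp
    show "has_velocity A \<gamma>' (g (\<gamma>' s) *\<^sub>R X (\<gamma>' s)) s"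
      unfolding has_velocity_def
    proof (intro ballI impI conjI)
      fix c assume c: "c \<in> charts A" "\<gamma>' s \<in> fst c"
      then have "\<forall>\<^sub>F u in nhds t. \<gamma> u \<in> fst c"
        and D: "((snd c \<circ> \<gamma>) has_vector_derivative comps (X (\<gamma> t)) c) (at t)"
        using vel[OF t(1)] t \<gamma>' by (auto simp: has_velocity_def)
      then obtain N where N: "open N" "t \<in> N" "\<And>u. u \<in> N \<Longrightarrow> \<gamma> u \<in> fst c"
        unfolding eventually_nhds by blast
      \<comment> \<open>On this neighbourhood of \<open>s\<close> the new curve stays in the chart
        domain and agrees with the old one after the inverse of \<open>\<tau>\<close>.\<close>
      have N': "open (\<tau> ` (N \<inter> I))" "s \<in> \<tau> ` (N \<inter> I)"
        using N I(1) t by (auto intro!: op)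
      show "\<forall>\<^sub>F u in nhds s. \<gamma>' u \<in> fst c"
        unfolding eventually_nhds
        by (rule exI[of _ "\<tau> ` (N \<inter> I)"]) (use N N' \<gamma>' in auto)
      let ?\<sigma> = "inv_into I \<tau>"
      have "(?\<sigma> has_derivative (\<lambda>h. h * g (\<gamma> t))) (at (\<tau> t))"
        by (rule has_derivative_inverse_strong[OF I(1) t(1) cont _ \<tau>[OF t(1), unfolded has_field_derivative_def]])
          (use inj nz[OF t(1)] in \<open>auto simp: fun_eq_iff\<close>)
      then have "(?\<sigma> has_vector_derivative g (\<gamma> t)) (at s)"
        by (simp add: t(2) has_vector_derivative_def)
      then have "((snd c \<circ> \<gamma> \<circ> ?\<sigma>) has_vector_derivative g (\<gamma> t) *\<^sub>R comps (X (\<gamma> t)) c) (at s)"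
        by (rule vector_diff_chain_at) (use D t inj in simp)
      then have "((snd c \<circ> \<gamma>') has_vector_derivative g (\<gamma> t) *\<^sub>R comps (X (\<gamma> t)) c) (at s)"
        by (rule has_vector_derivative_transform_within_open[OF _ N']) (use inj \<gamma>' in auto)
      then show "((snd c \<circ> \<gamma>') has_vector_derivative comps (g (\<gamma>' s) *\<^sub>R X (\<gamma>' s)) c) (at s)"
        using t \<gamma>' by simp
    qed
  qed
qed

section \<open>Liouville vector field\<close>

context
  fixes Q :: "('q, real^'n::finite) chart set"
  assumes Q: "smooth_atlas Q"
begin

lemma vector_field_natural_liouville: "vector_field (tangent_bundle Q) (natural_liouville Q)"
proof (rule vector_fieldI[OF smooth_atlas_tangent_bundle[OF Q]])
  fix y assume "y \<in> carrier (tangent_bundle Q)"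
  then obtain c where c: "c \<in> charts Q" "y \<in> fst (natural_chart Q c)"
    using bundle_chartE[OF Q] by metis
  let ?e = "natural_chart Q c"
  note e = natural_chart_in_charts[OF Q c(1)]
  have eq: "natural_liouville Q y = coord_vec (tangent_bundle Q) ?e (0, snd (snd ?e y)) y"
    if "y \<in> fst ?e" for y
    using natural_liouville_eq[OF Q c(1) smooth_function_const _ that] chart_liouville_eq[OF Q e that]
    by simp
  show "natural_liouville Q y \<in> tangent_space (tangent_bundle Q) y"
    unfolding eq[OF c(2)] by (rule coord_vec_in_tangent_space[OF smooth_atlas_tangent_bundle[OF Q] e c(2)])
  have op: "open (snd ?e ` fst ?e)"
    by (rule chart_open[OF smooth_atlas_tangent_bundle[OF Q] e])
  have "smooth_on (snd ?e ` fst ?e) (\<lambda>z. (0 :: real^'n, snd z))"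
    by (intro smooth_on_Pair smooth_on_const smooth_on_snd op)
  then have "smooth_on (snd ?e ` fst ?e) (rep ?e (natural_liouville Q))"
  proof (rule smooth_on_cong[OF _ op])
    fix z assume "z \<in> snd ?e ` fst ?e"
    then obtain y where y: "y \<in> fst ?e" "z = snd ?e y"
      by blast
    show "(0, snd z) = rep ?e (natural_liouville Q) z"
      unfolding y(2) inv_into_chart[OF chartD(1)[OF smooth_atlas_tangent_bundle[OF Q] e] y(1)] eq[OF y(1)]
        comps_coord_vec_self[OF smooth_atlas_tangent_bundle[OF Q] e y(1)] ..
  qed
  then show "\<exists>c\<in>charts (tangent_bundle Q). y \<in> fst c \<and> smooth_on (snd c ` fst c) (rep c (natural_liouville Q))"
    using e c(2) by blast
qed

text \<open>The change of coordinates \<open>\<psi>(x, u)\<close> from a scaled chart to an adapted chart has a derivative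
  commuting with \<open>(a, b) \<mapsto> (0, a)\<close>. As the fibres are complete, its first component is constant in
  \<open>u\<close>, so its second component is affine in \<open>u\<close>, and linear because it vanishes on the zero section.\<close>

lemma chart_liouville_adapted:
  assumes g: "smooth_function Q g" "\<forall>q\<in>carrier Q. g q \<noteq> 0"
    and S: "\<And>c y w. c \<in> charts Q \<Longrightarrow> y \<in> fst (scaled_chart Q g c) \<Longrightarrow> w \<in> tangent_space (tangent_bundle Q) y \<Longrightarrow>
      S y w = chart_tensor Q (scaled_chart Q g c) y w"
    and d: "d \<in> adapted_charts Q S" "y \<in> fst d"
  shows "natural_liouville Q y = chart_liouville Q d y"
proof -
  note TQ = smooth_atlas_tangent_bundle[OF Q]
  have d': "d \<in> charts (tangent_bundle Q)"
    and dom: "\<And>y. y \<in> fst d \<longleftrightarrow> y \<in> carrier (tangent_bundle Q) \<and> fst y \<in> fst ` fst d"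
    and Sd: "\<And>y w. y \<in> fst d \<Longrightarrow> w \<in> tangent_space (tangent_bundle Q) y \<Longrightarrow> S y w = chart_tensor Q d y w"
    and zero: "\<And>q. (q, 0) \<in> fst d \<Longrightarrow> snd (snd d (q, 0)) = 0"
    using d(1) unfolding adapted_charts_def by blast+
  have y: "y \<in> carrier (tangent_bundle Q)"
    using dom d(2) by blast
  then obtain c where c: "c \<in> charts Q" "fst y \<in> fst c"
    using bundle_chartE[OF Q] by metis
  define e where "e = scaled_chart Q g c"
  have e: "e \<in> charts (tangent_bundle Q)" "y \<in> fst e"
    using scaled_chart_in_charts[OF Q c(1) g] c y by (simp_all add: e_def carrier_tangent_bundle[OF Q])
  define W where "W = snd c ` (fst c \<inter> fst ` fst d)"
  define \<psi> where "\<psi> = transition e d"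
  define D where "D z = frechet_derivative \<psi> (at z)" for z
  \<comment> \<open>Here completeness of the fibres of \<open>d\<close> enters: the overlap is
    restricted in the base only, so its image is a product with the whole fibre space and rays in u
    never leave it.\<close>
  have "fst e \<inter> fst d = {y \<in> fst e. fst y \<in> fst ` fst d}"
    using dom chartD(2)[OF TQ e(1)] by blast
  then have W: "snd e ` (fst e \<inter> fst d) = W \<times> UNIV"
    using scaled_chart_image[OF Q c(1) g(2), of "fst ` fst d"] by (simp only: e_def W_def)
  have point: "\<exists>p. p \<in> fst e \<and> p \<in> fst d \<and> (x, u) = snd e p" if "x \<in> W" for x u
  proof -
    have "(x, u) \<in> snd e ` (fst e \<inter> fst d)"
      unfolding W using that by simp
    then show ?thesis
      by blast
  qed
  have "open (W \<times> (UNIV :: (real^'n) set))"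
    using open_overlap[OF TQ e(1) d'] by (simp add: W)
  then have opW: "open W"
    using open_image_fst[of "W \<times> (UNIV :: (real^'n) set)"] by simp
  have D: "(\<psi> has_derivative D (x, u)) (at (x, u))" if x: "x \<in> W" for x u
    using point[OF x, of u] has_derivative_transition[OF TQ e(1) d'] unfolding \<psi>_def D_def by metis
  \<comment> \<open>Both charts give \<open>S\<close> the same normal form. Applying
    \<open>S\<close> to the coordinate vector (a, 0) of \<open>e\<close> yields (0, a) there, and
    its image under the Jacobian can also be computed in \<open>d\<close>.\<close>
  have commute: "D (x, u) (0, a) = (0, fst (D (x, u) (a, 0)))" if x: "x \<in> W" for x u a
  proof -
    obtain p where p: "p \<in> fst e" "p \<in> fst d" "(x, u) = snd e p"
      using point[OF x] by blast
    let ?w = "coord_vec (tangent_bundle Q) e (a, 0) p"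
    have w: "?w \<in> tangent_space (tangent_bundle Q) p"
      by (rule coord_vec_in_tangent_space[OF TQ e(1) p(1)])
    have "coord_vec (tangent_bundle Q) e (0, a) p = S p ?w"
      using S[OF c(1) p(1)[unfolded e_def] w] chart_tensor_eq[OF Q e(1) p(1), of ?w]
      by (simp add: e_def[symmetric] comps_coord_vec_self[OF TQ e(1) p(1)])
    also have "\<dots> = coord_vec (tangent_bundle Q) d (0, fst (D (x, u) (a, 0))) p"
      using Sd[OF p(2) w] chart_tensor_eq[OF Q d' p(2), of ?w]
      by (simp add: comps_coord_vec[OF TQ d' p(2)] D_def \<psi>_def p(3))
    finally have "comps (coord_vec (tangent_bundle Q) e (0, a) p) d = (0, fst (D (x, u) (a, 0)))"
      by (simp add: comps_coord_vec_self[OF TQ d' p(2)])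
    then show ?thesis
      by (simp add: comps_coord_vec[OF TQ d' p(2)] D_def \<psi>_def p(3))
  qed
  have line: "((\<lambda>s. \<psi> (x, s *\<^sub>R u)) has_vector_derivative D (x, s *\<^sub>R u) (0, u)) (at s)" if x: "x \<in> W" for x u s
    using has_vector_derivative_along_line[of \<psi> "(x, 0)" s "(0, u)"] D[OF x, of "s *\<^sub>R u"]
    by (auto simp: D_def differentiable_def)
  have fst_const: "fst (\<psi> (x, u)) = fst (\<psi> (x, 0))" if x: "x \<in> W" for x u
  proof -
    have "((\<lambda>s. fst (\<psi> (x, s *\<^sub>R u))) has_vector_derivative 0) (at s)" for s
      using bounded_linear.has_vector_derivative[OF bounded_linear_fst line[OF x, of u s]]
      by (simp add: commute[OF x])
    then obtain k where "\<And>s. s \<in> UNIV \<Longrightarrow> fst (\<psi> (x, s *\<^sub>R u)) = k"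
      using has_vector_derivative_zero_constant[of UNIV "\<lambda>s. fst (\<psi> (x, s *\<^sub>R u))"] by auto
    from this[of 1] this[of 0] show ?thesis
      by simp
  qed
  define x where "x = snd c (fst y)"
  define u where "u = snd (snd e y)"
  have xu: "snd e y = (x, u)" "x \<in> W"
    using c(2) d(2) by (simp_all add: e_def x_def u_def W_def)
  \<comment> \<open>The functions x |-> fst (\<psi> (x, v)) coincide on \<open>W\<close> for all v,
    so their derivatives coincide as well.\<close>
  have D1_const: "fst (D (x, v) (a, 0)) = fst (D (x, 0) (a, 0))" for v a
  proof -
    have D': "((\<lambda>x. fst (\<psi> (x, v))) has_derivative (\<lambda>a. fst (D (x, v) (a, 0)))) (at x)" for v
    proof (rule has_derivative_fst, rule has_derivative_compose[where f = "\<lambda>x. (x, v)" and f' = "\<lambda>a. (a, 0)"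
          and g = \<psi> and g' = "D (x, v)"])
      show "((\<lambda>x. (x, v)) has_derivative (\<lambda>a. (a, 0))) (at x)"
        by (auto intro!: derivative_eq_intros)
    qed (rule D[OF xu(2)])
    have "((\<lambda>x. fst (\<psi> (x, 0))) has_derivative (\<lambda>a. fst (D (x, v) (a, 0)))) (at x)"
      by (rule has_derivative_transform_within_open[OF D' opW xu(2)]) (rule fst_const)
    from fun_cong[OF has_derivative_unique[OF this D'[of 0]]] show ?thesis .
  qed
  \<comment> \<open>The constant velocity of the fibre part of \<open>\<psi>\<close> along the ray
    through u.\<close>
  define K where "K = fst (D (x, 0) (u, 0))"
  have Ku: "D (x, s *\<^sub>R u) (0, u) = (0, K)" for s
    using D1_const[of "s *\<^sub>R u" u] by (simp add: commute[OF xu(2)] K_def)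
  have "((\<lambda>s. snd (\<psi> (x, s *\<^sub>R u)) - s *\<^sub>R K) has_vector_derivative 0) (at s)" for s
  proof -
    have "((\<lambda>s. snd (\<psi> (x, s *\<^sub>R u))) has_vector_derivative K) (at s)"
      using bounded_linear.has_vector_derivative[OF bounded_linear_snd line[OF xu(2), of u s]] by (simp add: Ku)
    moreover have "((\<lambda>s. s *\<^sub>R K) has_vector_derivative K) (at s)"
      unfolding has_vector_derivative_def by (auto intro!: derivative_eq_intros)
    ultimately show ?thesis
      using has_vector_derivative_diff by fastforce
  qed
  then obtain k where "\<And>s. s \<in> UNIV \<Longrightarrow> snd (\<psi> (x, s *\<^sub>R u)) - s *\<^sub>R K = k"
    using has_vector_derivative_zero_constant[of UNIV "\<lambda>s. snd (\<psi> (x, s *\<^sub>R u)) - s *\<^sub>R K"] by auto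
  from this[of 1] this[of 0] have K: "snd (\<psi> (x, u)) - K = snd (\<psi> (x, 0))"
    by simp
  \<comment> \<open>The zero vector over the base point of \<open>y\<close> lies in \<open>d\<close>
    because the domain is a union of fibres. There the fibre part of \<open>\<psi>\<close> vanishes,
    which fixes the constant of integration.\<close>
  have "(fst y, 0) \<in> carrier (tangent_bundle Q)"
    using y subspace_0[OF subspace_tangent_space[OF Q]] by (simp add: carrier_tangent_bundle[OF Q])
  moreover have "fst y \<in> fst ` fst d"
    using d(2) by blast
  ultimately have 0: "(fst y, 0) \<in> fst d" "(fst y, 0) \<in> fst e"
    using dom[of "(fst y, 0)"] c(2) by (auto simp: e_def carrier_tangent_bundle[OF Q])
  have "\<psi> (x, 0) = snd d (fst y, 0)"
    using transition_apply[OF chartD(1)[OF TQ e(1)] 0(2), of d] by (simp add: \<psi>_def e_def x_def)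
  moreover have "\<psi> (x, u) = snd d y"
    using transition_apply[OF chartD(1)[OF TQ e(1)] e(2), of d] by (simp add: \<psi>_def xu)
  ultimately have K': "K = snd (snd d y)"
    using K zero[OF 0(1)] by simp
  have "natural_liouville Q y = coord_vec (tangent_bundle Q) e (0, u) y"
    using natural_liouville_eq[OF Q c(1) g e(2)[unfolded e_def]] chart_liouville_eq[OF Q e]
    by (simp add: e_def[symmetric] u_def)
  also have "\<dots> = coord_vec (tangent_bundle Q) d (D (x, u) (0, u)) y"
    unfolding D_def \<psi>_def xu(1)[symmetric] by (rule coord_vec_change[OF TQ e(1) d' e(2) d(2)])
  also have "\<dots> = chart_liouville Q d y"
    using Ku[of 1] chart_liouville_eq[OF Q d' d(2)] by (simp add: K')
  finally show ?thesis .
qed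

end

section \<open>The Sundman transformation in scaled coordinates\<close>

lemma linear_axis_sum:
  fixes L :: "real^'k::finite \<Rightarrow> real"
  assumes "linear L"
  shows "(\<Sum>j\<in>UNIV. L (axis j 1) * (v $ j)) = L v"
  using linear_sum[OF assms, of "\<lambda>i. (v $ i) *\<^sub>R axis i 1" UNIV] sum_axis[of v]
  by (simp add: linear_scale[OF assms] mult.commute)

context
  fixes Q :: "('q, real^'n::finite) chart set" and f :: "'q \<Rightarrow> real" and c :: "('q, real^'n) chart"
  assumes Q: "smooth_atlas Q" and f: "smooth_function Q f" "\<forall>q\<in>carrier Q. f q \<noteq> 0" and c: "c \<in> charts Q"
begin

lemma has_derivative_coord_deriv:
  assumes "q \<in> fst c"
  shows "((\<lambda>x. f (inv_into (fst c) (snd c) x)) has_derivative (\<lambda>b. coord_deriv c b f q)) (at (snd c q))"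
    and "linear (\<lambda>b. coord_deriv c b f q)"
proof -
  have d: "(f \<circ> inv_into (fst c) (snd c)) differentiable (at (snd c q))"
    using smooth_on_differentiable[OF smooth_function_chart[OF f(1) c]] assms by (auto simp: o_def)
  show "((\<lambda>x. f (inv_into (fst c) (snd c) x)) has_derivative (\<lambda>b. coord_deriv c b f q)) (at (snd c q))"
    using has_derivative_frechet_derivative[OF d] by (simp add: coord_deriv_def o_def)
  show "linear (\<lambda>b. coord_deriv c b f q)"
    using linear_frechet_derivative[OF d] by (simp add: coord_deriv_def)
qed

text \<open>The vector field f \<Gamma> is not vertical, so the full Jacobian is needed, but only
  over a single base chart, where the transition is (x, v) |-> (x, f(x) v) and the product rule
  applies.\<close>

lemma jacobian_natural_scaled:
  assumes y: "y \<in> fst (scaled_chart Q f c)"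
  shows "jacobian (natural_chart Q c) (scaled_chart Q f c) y (a, b) =
    (a, coord_deriv c a f (fst y) *\<^sub>R comps (snd y) c + f (fst y) *\<^sub>R b)"
proof -
  let ?W = "snd c ` fst c \<times> (UNIV :: (real^'n) set)"
  let ?u = "(snd c (fst y), comps (snd y) c)"
  let ?F = "\<lambda>x. f (inv_into (fst c) (snd c) x)"
  have q: "fst y \<in> fst c"
    using y by simp
  have W: "open ?W" "?u \<in> ?W"
    using chart_open[OF Q c] q by (auto simp: open_Times)
  have F: "((\<lambda>z. ?F (fst z)) has_derivative (\<lambda>b. coord_deriv c (fst b) f (fst y))) (at ?u)"
  proof (rule has_derivative_compose[where f = fst and f' = fst and g = ?F
        and g' = "\<lambda>b. coord_deriv c b f (fst y)"])
    show "(fst has_derivative fst) (at ?u)"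
      by (rule bounded_linear_imp_has_derivative[OF bounded_linear_fst])
  qed (use has_derivative_coord_deriv(1)[OF q] in simp)
  have snd: "(snd has_derivative snd) (at ?u)"
    by (rule bounded_linear_imp_has_derivative[OF bounded_linear_snd])
  have fst: "(fst has_derivative fst) (at ?u)"
    by (rule bounded_linear_imp_has_derivative[OF bounded_linear_fst])
  have "((\<lambda>z. (fst z, ?F (fst z) *\<^sub>R snd z)) has_derivative
      (\<lambda>b. (fst b, f (fst y) *\<^sub>R snd b + coord_deriv c (fst b) f (fst y) *\<^sub>R comps (snd y) c))) (at ?u)"
    using has_derivative_Pair[OF fst has_derivative_scaleR[OF F snd]]
      inv_into_chart[OF chartD(1)[OF Q c] q] by simp
  then have "(transition (natural_chart Q c) (scaled_chart Q f c) has_derivative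
      (\<lambda>b. (fst b, f (fst y) *\<^sub>R snd b + coord_deriv c (fst b) f (fst y) *\<^sub>R comps (snd y) c))) (at ?u)"
  proof (rule has_derivative_transform_within_open[OF _ W])
    fix z assume "z \<in> ?W"
    then obtain q v where q: "q \<in> fst c" "z = (snd c q, v)"
      by auto
    show "(fst z, ?F (fst z) *\<^sub>R snd z) = transition (natural_chart Q c) (scaled_chart Q f c) z"
      unfolding q(2) using transition_scaled_chart[OF Q c c _ q(1,1), of "\<lambda>_. 1" f v]
        inv_into_chart[OF chartD(1)[OF Q c] q(1)] jacobian_self[OF Q c q(1)] by simp
  qed
  from fun_cong[OF frechet_derivative_eqI[OF this], of "(a, b)"] show ?thesis
    by (simp add: add.commute)
qed

text \<open>Scaling keeps the base coordinates and f is constant on fibres, so its x-derivatives on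
  the bundle are those on the base.\<close>

lemma coord_deriv_scaled:
  assumes y: "y \<in> fst (scaled_chart Q f c)"
  shows "coord_deriv (scaled_chart Q f c) (b, 0) (f \<circ> fst) y = coord_deriv c b f (fst y)"
proof -
  let ?d = "scaled_chart Q f c"
  let ?F = "\<lambda>x. f (inv_into (fst c) (snd c) x)"
  have d: "?d \<in> charts (tangent_bundle Q)"
    by (rule scaled_chart_in_charts[OF Q c f])
  have q: "fst y \<in> fst c"
    using y by simp
  have "((\<lambda>z. ?F (fst z)) has_derivative (\<lambda>b. coord_deriv c (fst b) f (fst y))) (at (snd ?d y))"
  proof (rule has_derivative_compose[where f = fst and f' = fst and g = ?F
        and g' = "\<lambda>b. coord_deriv c b f (fst y)"])
    show "(fst has_derivative fst) (at (snd ?d y))"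
      by (rule bounded_linear_imp_has_derivative[OF bounded_linear_fst])
  qed (use has_derivative_coord_deriv(1)[OF q] in simp)
  then have "((f \<circ> fst \<circ> inv_into (fst ?d) (snd ?d)) has_derivative
      (\<lambda>b. coord_deriv c (fst b) f (fst y))) (at (snd ?d y))"
  proof (rule has_derivative_transform_within_open)
    show "open (snd ?d ` fst ?d)" "snd ?d y \<in> snd ?d ` fst ?d"
      using chart_open[OF smooth_atlas_tangent_bundle[OF Q] d] y by blast+
    fix z assume "z \<in> snd ?d ` fst ?d"
    then obtain y' where y': "y' \<in> fst ?d" "z = snd ?d y'"
      by blast
    then have "fst y' \<in> fst c"
      by simp
    then show "?F (fst z) = (f \<circ> fst \<circ> inv_into (fst ?d) (snd ?d)) z"
      unfolding y'(2) o_apply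
        inv_into_chart[OF chartD(1)[OF smooth_atlas_tangent_bundle[OF Q] d] y'(1)]
      by (simp add: inv_into_chart[OF chartD(1)[OF Q c]])
  qed
  from fun_cong[OF frechet_derivative_eqI[OF this], of "(b, 0)"] show ?thesis
    by (simp add: coord_deriv_def)
qed

section \<open>The SODE in scaled coordinates and the equation of its base curves\<close>

context
  fixes \<Gamma> :: "('q, 'n) tb \<Rightarrow> ('q, 'n) tb_tvec" and Xc :: "real^'n \<Rightarrow> real^'n \<Rightarrow> real^'n"
  assumes \<Gamma>: "\<And>y x v. y \<in> fst (natural_chart Q c) \<Longrightarrow> snd (natural_chart Q c) y = (x, v) \<Longrightarrow>
      \<Gamma> y = (\<Sum>i\<in>UNIV. (v $ i) *\<^sub>R ddx Q (natural_chart Q c) i y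
                  + (Xc x v $ i) *\<^sub>R ddu Q (natural_chart Q c) i y)"
begin

lemma sode_coord_vec:
  assumes y: "y \<in> fst (natural_chart Q c)"
  shows "\<Gamma> y = coord_vec (tangent_bundle Q) (natural_chart Q c)
    (comps (snd y) c, Xc (snd c (fst y)) (comps (snd y) c)) y"
proof -
  note e = natural_chart_in_charts[OF Q c] y
  have "snd (natural_chart Q c) y = (snd c (fst y), comps (snd y) c)"
    by simp
  from \<Gamma>[OF y this] show ?thesis
    by (simp add: sum.distrib coord_vec_sum_axis[OF Q e]
        flip: linear_add[OF coord_vec_linear[OF smooth_atlas_tangent_bundle[OF Q] e]])
qed

text \<open>In natural coordinates the field is f (w, X). The Jacobian sends it to (v, df(v) w + f^2
  X) with v = f w; writing w as v / f and expanding df(v) along the axes gives the stated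
  coefficients.\<close>

lemma scaled_sode_local_expression:
  assumes y: "y \<in> fst (scaled_chart Q f c)" "snd (scaled_chart Q f c) y = (x, v)"
  shows "f (fst y) *\<^sub>R \<Gamma> y = (\<Sum>j\<in>UNIV. (v $ j) *\<^sub>R ddx Q (scaled_chart Q f c) j y) +
    (\<Sum>i\<in>UNIV. ((\<Sum>j\<in>UNIV. 1 / f (fst y) *
        coord_deriv (scaled_chart Q f c) (axis j 1, 0) (f \<circ> fst) y * (v $ j) * (v $ i))
      + (f (fst y))\<^sup>2 * (Xc x (v /\<^sub>R f (fst y)) $ i)) *\<^sub>R ddu Q (scaled_chart Q f c) i y)"
proof -
  let ?e = "natural_chart Q c" and ?d = "scaled_chart Q f c"
  let ?r = "f (fst y)"
  note TQ = smooth_atlas_tangent_bundle[OF Q]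
  have q: "fst y \<in> fst c" and y': "y \<in> fst ?e"
    using y by simp_all
  have r: "?r \<noteq> 0"
    using f(2) chartD(2)[OF Q c q] by blast
  note d = scaled_chart_in_charts[OF Q c f] y(1)
  note e = natural_chart_in_charts[OF Q c] y'
  note lin = has_derivative_coord_deriv(2)[OF q]
  let ?w = "comps (snd y) c"
  have x: "x = snd c (fst y)" and v: "v = ?r *\<^sub>R ?w"
    using y(2) by simp_all
  then have w: "v /\<^sub>R ?r = ?w"
    using r by simp
  let ?X = "Xc x ?w"
  have "?r *\<^sub>R \<Gamma> y = coord_vec (tangent_bundle Q) ?e (?r *\<^sub>R (?w, ?X)) y"
    using linear_scale[OF coord_vec_linear[OF TQ e], of ?r] by (simp only: sode_coord_vec[OF y'] x)
  also have "\<dots> = coord_vec (tangent_bundle Q) ?d (jacobian ?e ?d y (v, ?r *\<^sub>R ?X)) y"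
    using coord_vec_change[OF TQ e(1) d(1) e(2) d(2)] by (simp only: scaleR_Pair v)
  also have "jacobian ?e ?d y (v, ?r *\<^sub>R ?X) = (v, coord_deriv c v f (fst y) *\<^sub>R ?w + ?r *\<^sub>R ?r *\<^sub>R ?X)"
    by (rule jacobian_natural_scaled[OF y(1)])
  also have "coord_deriv c v f (fst y) *\<^sub>R ?w + ?r *\<^sub>R ?r *\<^sub>R ?X =
      (\<chi> i. (\<Sum>j\<in>UNIV. 1 / ?r * coord_deriv ?d (axis j 1, 0) (f \<circ> fst) y * (v $ j) * (v $ i))
        + ?r\<^sup>2 * (Xc x (v /\<^sub>R ?r) $ i))" (is "_ = ?R")
  proof (rule vec_eq_iff[THEN iffD2], rule allI)
    fix i
    have "(\<Sum>j\<in>UNIV. 1 / ?r * coord_deriv ?d (axis j 1, 0) (f \<circ> fst) y * (v $ j) * (v $ i)) =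
        (v $ i) / ?r * (\<Sum>j\<in>UNIV. coord_deriv c (axis j 1) f (fst y) * (v $ j))"
      by (simp add: coord_deriv_scaled[OF y(1)] sum_distrib_left field_simps)
    also have "\<dots> = (?w $ i) * coord_deriv c v f (fst y)"
      unfolding linear_axis_sum[OF lin] using r by (simp add: v)
    finally show "(coord_deriv c v f (fst y) *\<^sub>R ?w + ?r *\<^sub>R ?r *\<^sub>R ?X) $ i = ?R $ i"
      by (simp add: w power2_eq_square mult.commute)
  qed
  also have "coord_vec (tangent_bundle Q) ?d (v, ?R) y =
      coord_vec (tangent_bundle Q) ?d (v, 0) y + coord_vec (tangent_bundle Q) ?d (0, ?R) y"
    using linear_add[OF coord_vec_linear[OF TQ d], of "(v, 0)" "(0, ?R)"] by simp
  finally show ?thesis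
    using coord_vec_sum_axis(1)[OF Q d, of v] coord_vec_sum_axis(2)[OF Q d, of ?R] by simp
qed

text \<open>Natural coordinates are enough: along the curve x' = f v and v' = f X, hence x'' = df(f
  v) v + f^2 X, where v = x' / f is substituted at the end.\<close>

lemma scaled_sode_second_order_equation:
  assumes \<gamma>: "integral_curve (tangent_bundle Q) (\<lambda>y. f (fst y) *\<^sub>R \<Gamma> y) J \<gamma>"
    and s: "s \<in> J" "fst (\<gamma> s) \<in> fst c"
    and x: "x = (\<lambda>i s. snd c (fst (\<gamma> s)) $ i)" and q: "q = fst (\<gamma> s)"
  shows "(x i has_real_derivative deriv (x i) s) (at s)"
    and "(deriv (x i) has_real_derivative
      (\<Sum>j\<in>UNIV. 1 / f q * coord_deriv c (axis j 1) f q * deriv (x j) s) * deriv (x i) s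
      + (f q)\<^sup>2 * (Xc (\<chi> j. x j s) (\<chi> j. 1 / f q * deriv (x j) s) $ i)) (at s)"
proof -
  note TQ = smooth_atlas_tangent_bundle[OF Q]
  let ?e = "natural_chart Q c"
  note e = natural_chart_in_charts[OF Q c]
  let ?F = "\<lambda>x. f (inv_into (fst c) (snd c) x)"
  define \<xi> where "\<xi> s = snd c (fst (\<gamma> s))" for s
  define v where "v s = comps (snd (\<gamma> s)) c" for s
  define r where "r s = f (fst (\<gamma> s))" for s
  have J: "open J" "\<And>s. s \<in> J \<Longrightarrow> \<gamma> s \<in> carrier (tangent_bundle Q)"
    and vel: "\<And>s. s \<in> J \<Longrightarrow> has_velocity (tangent_bundle Q) \<gamma> (r s *\<^sub>R \<Gamma> (\<gamma> s)) s"
    using \<gamma> by (auto simp: integral_curve_def r_def)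
  have dom: "\<gamma> s \<in> fst ?e"
    using s J(2)[OF s(1)] by (simp add: carrier_tangent_bundle[OF Q])
  have "\<forall>\<^sub>F s in nhds s. \<gamma> s \<in> fst ?e"
    using vel[OF s(1)] e dom unfolding has_velocity_def by blast
  then obtain N where N: "open N" "s \<in> N" "\<And>s. s \<in> N \<Longrightarrow> \<gamma> s \<in> fst ?e"
    unfolding eventually_nhds by blast
  \<comment> \<open>The formula for \<open>deriv (x i)\<close> is needed on a whole neighbourhood of
    \<open>s\<close>, since it is about to be differentiated.\<close>
  define M where "M = N \<inter> J"
  have M: "open M" "s \<in> M" "\<And>s. s \<in> M \<Longrightarrow> \<gamma> s \<in> fst ?e" "\<And>s. s \<in> M \<Longrightarrow> s \<in> J"
    using N J(1) s(1) by (auto simp: M_def)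
  have D: "((\<lambda>s. (\<xi> s, v s)) has_vector_derivative (r t *\<^sub>R v t, r t *\<^sub>R Xc (\<xi> t) (v t))) (at t)"
    if t: "t \<in> M" for t
  proof -
    have "snd ?e \<circ> \<gamma> = (\<lambda>s. (\<xi> s, v s))"
      by (auto simp: \<xi>_def v_def fun_eq_iff)
    moreover have "comps (r t *\<^sub>R \<Gamma> (\<gamma> t)) ?e = (r t *\<^sub>R v t, r t *\<^sub>R Xc (\<xi> t) (v t))"
      by (simp add: sode_coord_vec[OF M(3)[OF t]] comps_coord_vec_self[OF TQ e M(3)[OF t]] \<xi>_def v_def)
    moreover have "((snd ?e \<circ> \<gamma>) has_vector_derivative comps (r t *\<^sub>R \<Gamma> (\<gamma> t)) ?e) (at t)"
      using vel[OF M(4)[OF t]] e M(3)[OF t] unfolding has_velocity_def by blast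
    ultimately show ?thesis
      by metis
  qed
  have D\<xi>: "(\<xi> has_vector_derivative r t *\<^sub>R v t) (at t)" if t: "t \<in> M" for t
    using bounded_linear.has_vector_derivative[OF bounded_linear_fst D[OF t]] by simp
  have Dv: "(v has_vector_derivative r t *\<^sub>R Xc (\<xi> t) (v t)) (at t)" if t: "t \<in> M" for t
    using bounded_linear.has_vector_derivative[OF bounded_linear_snd D[OF t]] by simp
  have Dx: "(x i has_real_derivative r t * (v t $ i)) (at t)" if t: "t \<in> M" for t i
    using bounded_linear.has_vector_derivative[OF bounded_linear_vec_nth D\<xi>[OF t], of i]
    by (simp add: x \<xi>_def has_real_derivative_iff_has_vector_derivative)
  then have dx: "deriv (x i) t = r t * (v t $ i)" if "t \<in> M" for t i
    using that by (blast intro: DERIV_imp_deriv)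
  show "(x i has_real_derivative deriv (x i) s) (at s)"
    using Dx[OF M(2)] dx[OF M(2)] by simp
  have qs: "q \<in> fst c" "r s = f q" "\<xi> s = snd c q"
    using s(2) by (simp_all add: q r_def \<xi>_def)
  have nz: "f q \<noteq> 0"
    using f(2) chartD(2)[OF Q c qs(1)] by blast
  note lin = has_derivative_coord_deriv(2)[OF qs(1)]
  have "((\<lambda>s. ?F (\<xi> s)) has_derivative (\<lambda>h. coord_deriv c (h *\<^sub>R (r s *\<^sub>R v s)) f q)) (at s)"
    by (rule has_derivative_compose[where f = \<xi> and f' = "\<lambda>h. h *\<^sub>R (r s *\<^sub>R v s)" and g = ?F
          and g' = "\<lambda>b. coord_deriv c b f q"])
      (use D\<xi>[OF M(2)] has_derivative_coord_deriv(1)[OF qs(1)] qs in \<open>simp_all add: has_vector_derivative_def\<close>)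
  then have DF: "((\<lambda>s. ?F (\<xi> s)) has_real_derivative coord_deriv c (r s *\<^sub>R v s) f q) (at s)"
    unfolding linear_scale[OF lin] by (simp add: has_field_derivative_def mult_commute_abs)
  have Dvi: "((\<lambda>s. v s $ i) has_real_derivative r s * (Xc (\<xi> s) (v s) $ i)) (at s)"
    using bounded_linear.has_vector_derivative[OF bounded_linear_vec_nth Dv[OF M(2)], of i]
    by (simp add: has_real_derivative_iff_has_vector_derivative)
  have "((\<lambda>s. ?F (\<xi> s) * (v s $ i)) has_real_derivative
      coord_deriv c (r s *\<^sub>R v s) f q * (v s $ i) + r s * (Xc (\<xi> s) (v s) $ i) * ?F (\<xi> s)) (at s)"
    by (rule DERIV_mult[OF DF Dvi])
  then have "(deriv (x i) has_real_derivative
      coord_deriv c (r s *\<^sub>R v s) f q * (v s $ i) + r s * (Xc (\<xi> s) (v s) $ i) * ?F (\<xi> s)) (at s)"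
  proof (rule has_field_derivative_transform_within_open[OF _ M(1,2)])
    fix t assume t: "t \<in> M"
    then have "fst (\<gamma> t) \<in> fst c"
      using M(3) by simp
    then show "?F (\<xi> t) * (v t $ i) = deriv (x i) t"
      by (simp add: dx[OF t] \<xi>_def r_def inv_into_chart[OF chartD(1)[OF Q c]])
  qed
  moreover have "?F (\<xi> s) = f q"
    using inv_into_chart[OF chartD(1)[OF Q c] qs(1)] qs(3) by simp
  moreover have "coord_deriv c (r s *\<^sub>R v s) f q * (v s $ i) =
      (\<Sum>j\<in>UNIV. 1 / f q * coord_deriv c (axis j 1) f q * deriv (x j) s) * deriv (x i) s"
  proof -
    have "(\<Sum>j\<in>UNIV. 1 / f q * coord_deriv c (axis j 1) f q * deriv (x j) s) =
        1 / f q * (\<Sum>j\<in>UNIV. coord_deriv c (axis j 1) f q * ((r s *\<^sub>R v s) $ j))"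
      by (simp add: dx[OF M(2)] sum_distrib_left mult.assoc)
    then show ?thesis
      using nz by (simp only: linear_axis_sum[OF lin] dx[OF M(2)] qs(2)) simp
  qed
  moreover have "(\<chi> j. x j s) = \<xi> s" "(\<chi> j. 1 / f q * deriv (x j) s) = v s"
    using nz by (simp add: x \<xi>_def vec_eq_iff, simp add: dx[OF M(2)] qs(2) vec_eq_iff)
  ultimately show "(deriv (x i) has_real_derivative
      (\<Sum>j\<in>UNIV. 1 / f q * coord_deriv c (axis j 1) f q * deriv (x j) s) * deriv (x i) s
      + (f q)\<^sup>2 * (Xc (\<chi> j. x j s) (\<chi> j. 1 / f q * deriv (x j) s) $ i)) (at s)"
    by (simp add: qs(2) power2_eq_square mult_ac)
qed

end

end

section \<open>Assembly of the three claims\<close>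

theorem mainTheorem2:
  fixes Q :: "('q, real^'n::finite) chart set"
    and \<Gamma> \<Gamma>' :: "('q, 'n) tb \<Rightarrow> ('q, 'n) tb_tvec"
    and X :: "('q, real^'n) chart \<Rightarrow> real^'n \<Rightarrow> real^'n \<Rightarrow> real^'n"
    and f :: "'q \<Rightarrow> real"
    and S' :: "('q, 'n) tb \<Rightarrow> ('q, 'n) tb_tvec \<Rightarrow> ('q, 'n) tb_tvec"
  assumes manifold: "smooth_manifold Q"
    and sode: "is_sode Q (natural_structure Q) (natural_liouville Q) \<Gamma>"
    and local_expr: "\<And>c y x v. c \<in> charts Q \<Longrightarrow> y \<in> fst (natural_chart Q c) \<Longrightarrow>
        snd (natural_chart Q c) y = (x, v) \<Longrightarrow>
        \<Gamma> y = (\<Sum>i\<in>UNIV. (v $ i) *\<^sub>R ddx Q (natural_chart Q c) i y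
                    + (X c x v $ i) *\<^sub>R ddu Q (natural_chart Q c) i y)"
    and f_smooth: "smooth_function Q f"
    and f_sign: "(\<forall>q\<in>carrier Q. f q > 0) \<or> (\<forall>q\<in>carrier Q. f q < 0)"
    and \<Gamma>'_def: "\<Gamma>' = (\<lambda>y. f (fst y) *\<^sub>R \<Gamma> y)"
    and S'_def: "S' = (\<lambda>y w. inverse (f (fst y)) *\<^sub>R natural_structure Q y w)"
  shows
    \<comment> \<open>(1)\<close>
    "(\<forall>I \<gamma> \<tau>. integral_curve (tangent_bundle Q) \<Gamma> I \<gamma> \<and>
        (\<forall>t\<in>I. (\<tau> has_real_derivative 1 / f (fst (\<gamma> t))) (at t)) \<longrightarrow>
        inj_on \<tau> I \<and>
        (\<forall>\<gamma>'. (\<forall>t\<in>I. \<gamma>' (\<tau> t) = \<gamma> t) \<longrightarrow> integral_curve (tangent_bundle Q) \<Gamma>' (\<tau> ` I) \<gamma>')) \<and>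
    \<comment> \<open>(2)\<close>
     (\<forall>c\<in>charts Q. let d = scaled_chart Q f c in
        d \<in> charts (tangent_bundle Q) \<and>
        (\<forall>y\<in>fst d. let x = fst (snd d y); v = snd (snd d y); r = f (fst y) in
           \<Gamma>' y =
             (\<Sum>j\<in>UNIV. (v $ j) *\<^sub>R ddx Q d j y) +
             (\<Sum>i\<in>UNIV.
                ((\<Sum>j\<in>UNIV. 1 / r * coord_deriv d (axis j 1, 0) (f \<circ> fst) y * (v $ j) * (v $ i))
                  + r\<^sup>2 * (X c x (v /\<^sub>R r) $ i)) *\<^sub>R ddu Q d i y)) \<and>
        (\<forall>J \<gamma>. integral_curve (tangent_bundle Q) \<Gamma>' J \<gamma> \<longrightarrow>
           (let x = (\<lambda>i s. snd c (fst (\<gamma> s)) $ i) in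
            \<forall>s\<in>J. fst (\<gamma> s) \<in> fst c \<longrightarrow> (let q = fst (\<gamma> s) in
              \<forall>i. (x i has_real_derivative deriv (x i) s) (at s) \<and>
                (deriv (x i) has_real_derivative
                  (\<Sum>j\<in>UNIV. 1 / f q * coord_deriv c (axis j 1) f q * deriv (x j) s) * deriv (x i) s
                  + (f q)\<^sup>2 * (X c (\<chi> j. x j s) (\<chi> j. 1 / f q * deriv (x j) s) $ i)) (at s))))) \<and>
    \<comment> \<open>(3)\<close>
     ((\<exists>q\<in>carrier Q. f q \<noteq> 1) \<longrightarrow>
        \<not> is_sode Q (natural_structure Q) (natural_liouville Q) \<Gamma>') \<and>
     almost_tangent_structure (tangent_bundle Q) S' \<and>
     integrable_structure (tangent_bundle Q) S' \<and>
     (\<forall>c\<in>charts Q. \<forall>y\<in>fst (scaled_chart Q f c).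
        (\<forall>w\<in>tangent_space (tangent_bundle Q) y. S' y w = chart_tensor Q (scaled_chart Q f c) y w) \<and>
        natural_liouville Q y = chart_liouville Q (scaled_chart Q f c) y) \<and>
     is_liouville_of Q S' (natural_liouville Q) \<and>
     is_sode Q S' (natural_liouville Q) \<Gamma>'"
proof -
  have Q: "smooth_atlas Q"
    using manifold by (simp add: smooth_manifold_def)
  note TQ = smooth_atlas_tangent_bundle[OF Q]
  have nz: "\<forall>q\<in>carrier Q. f q \<noteq> 0"
    using f_sign by fastforce
  note f = f_smooth nz
  have nz': "\<forall>y\<in>carrier (tangent_bundle Q). f (fst y) \<noteq> 0"
    using nz carrier_tangent_bundle[OF Q] by blast
  have \<Gamma>: "vector_field (tangent_bundle Q) \<Gamma>"
    "\<And>y. y \<in> carrier (tangent_bundle Q) \<Longrightarrow> natural_structure Q y (\<Gamma> y) = natural_liouville Q y"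
    using sode by (auto simp: is_sode_def)
  have \<Gamma>_tangent: "\<Gamma> y \<in> tangent_space (tangent_bundle Q) y" if "y \<in> carrier (tangent_bundle Q)" for y
    using \<Gamma>(1) that by (simp add: vector_field_def)
  note scaled = scaled_chart_in_charts[OF Q _ f]
  have nz_c: "f (fst y) \<noteq> 0" if "c \<in> charts Q" "y \<in> fst (scaled_chart Q f c)" for c y
    using nz' chartD(2)[OF TQ scaled[OF that(1)] that(2)] by blast
  have S'_scaled: "S' y w = chart_tensor Q (scaled_chart Q f c) y w"
    if "c \<in> charts Q" "y \<in> fst (scaled_chart Q f c)" "w \<in> tangent_space (tangent_bundle Q) y" for c y w
    using natural_structure_eq[OF Q that(1) f that(2,3)] nz_c[OF that(1,2)] by (simp add: S'_def)
  have scaled_cover: "\<exists>c\<in>charts Q. y \<in> fst (scaled_chart Q f c)" if "y \<in> carrier (tangent_bundle Q)" for y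
    using bundle_chartE[OF Q that] by (metis scaled_chart_simps(1))
  \<comment> \<open>The matrix of (d/du) (x) dx in scaled coordinates: its kernel and its range both
    consist of the vertical pairs (0, b).\<close>
  define J :: "(real^'n) \<times> (real^'n) \<Rightarrow> (real^'n) \<times> (real^'n)" where "J b = (0, fst b)" for b
  have J: "linear J" "{b. J b = 0} = range J" "\<And>b. J (J b) = 0"
    by (auto simp: J_def linear_iff zero_prod_def image_iff)
  have S'_const: "\<exists>d\<in>charts (tangent_bundle Q). y \<in> fst d \<and>
      (\<forall>p\<in>fst d. \<forall>w\<in>tangent_space (tangent_bundle Q) p. S' p w = coord_vec (tangent_bundle Q) d (J (comps w d)) p)"
    if y: "y \<in> carrier (tangent_bundle Q)" for y
  proof -
    obtain c where c: "c \<in> charts Q" "y \<in> fst (scaled_chart Q f c)"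
      using scaled_cover[OF y] by blast
    have "S' p w = coord_vec (tangent_bundle Q) (scaled_chart Q f c) (J (comps w (scaled_chart Q f c))) p"
      if "p \<in> fst (scaled_chart Q f c)" "w \<in> tangent_space (tangent_bundle Q) p" for p w
      unfolding S'_scaled[OF c(1) that] J_def by (rule chart_tensor_eq[OF Q scaled[OF c(1)] that(1)])
    then show ?thesis
      using scaled[OF c(1)] c(2) by blast
  qed
  \<comment> \<open>Homogeneity is available for \<open>S'\<close> as a constant coefficient tensor,
    so the factor f is pulled out of \<open>S'\<close> and the value of the natural structure
    follows from it.\<close>
  have natural_\<Gamma>': "natural_structure Q y (\<Gamma>' y) = f (fst y) *\<^sub>R natural_liouville Q y"
    and S'_\<Gamma>': "S' y (\<Gamma>' y) = natural_liouville Q y" if y: "y \<in> carrier (tangent_bundle Q)" for y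
  proof -
    have fy: "f (fst y) \<noteq> 0"
      using nz' y by blast
    have "S' y (\<Gamma>' y) = f (fst y) *\<^sub>R S' y (\<Gamma> y)"
      unfolding \<Gamma>'_def
      by (rule constant_coeff_linear(2)[OF TQ J(1) S'_const y \<Gamma>_tangent[OF y] \<Gamma>_tangent[OF y]])
    then show S'\<Gamma>': "S' y (\<Gamma>' y) = natural_liouville Q y"
      using fy by (simp add: S'_def \<Gamma>(2)[OF y])
    have "natural_structure Q y (\<Gamma>' y) = f (fst y) *\<^sub>R S' y (\<Gamma>' y)"
      using fy by (simp add: S'_def)
    then show "natural_structure Q y (\<Gamma>' y) = f (fst y) *\<^sub>R natural_liouville Q y"
      by (simp only: S'\<Gamma>')
  qed
  have \<Gamma>'_field: "vector_field (tangent_bundle Q) \<Gamma>'"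
    unfolding \<Gamma>'_def
  proof (rule vector_field_scaleR[OF TQ \<Gamma>(1)])
    fix y assume "y \<in> carrier (tangent_bundle Q)"
    then obtain c where c: "c \<in> charts Q" "y \<in> fst (natural_chart Q c)"
      using bundle_chartE[OF Q] by metis
    let ?e = "natural_chart Q c"
    note e = natural_chart_in_charts[OF Q c(1)]
    have op: "open (snd ?e ` fst ?e)"
      by (rule chart_open[OF TQ e])
    have "smooth_on (snd ?e ` fst ?e) (\<lambda>z. f (inv_into (fst c) (snd c) (fst z)))"
      by (rule smooth_on_compose[OF smooth_function_chart[OF f_smooth c(1)] smooth_on_fst[OF op] op]) auto
    then have "smooth_on (snd ?e ` fst ?e) (\<lambda>z. f (fst (inv_into (fst ?e) (snd ?e) z)))"
    proof (rule smooth_on_cong[OF _ op])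
      fix z assume "z \<in> snd ?e ` fst ?e"
      then obtain p where p: "p \<in> fst ?e" "z = snd ?e p"
        by blast
      then have "fst p \<in> fst c"
        by simp
      then show "f (inv_into (fst c) (snd c) (fst z)) = f (fst (inv_into (fst ?e) (snd ?e) z))"
        unfolding p(2) inv_into_chart[OF chartD(1)[OF TQ e] p(1)]
        by (simp add: inv_into_chart[OF chartD(1)[OF Q c(1)]])
    qed
    then show "\<exists>c\<in>charts (tangent_bundle Q). y \<in> fst c \<and>
        smooth_on (snd c ` fst c) (\<lambda>z. f (fst (inv_into (fst c) (snd c) z)))"
      using e c(2) by blast
  qed
  have part1: "inj_on \<tau> I \<and>
      (\<forall>\<gamma>'. (\<forall>t\<in>I. \<gamma>' (\<tau> t) = \<gamma> t) \<longrightarrow> integral_curve (tangent_bundle Q) \<Gamma>' (\<tau> ` I) \<gamma>')"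
    if "integral_curve (tangent_bundle Q) \<Gamma> I \<gamma>"
      "\<forall>t\<in>I. (\<tau> has_real_derivative 1 / f (fst (\<gamma> t))) (at t)" for I \<gamma> \<tau>
    using integral_curve_reparametrize[OF that(1) bspec[OF that(2)] nz'] unfolding \<Gamma>'_def by blast
  have part2: "let d = scaled_chart Q f c in
        d \<in> charts (tangent_bundle Q) \<and>
        (\<forall>y\<in>fst d. let x = fst (snd d y); v = snd (snd d y); r = f (fst y) in
           \<Gamma>' y =
             (\<Sum>j\<in>UNIV. (v $ j) *\<^sub>R ddx Q d j y) +
             (\<Sum>i\<in>UNIV.
                ((\<Sum>j\<in>UNIV. 1 / r * coord_deriv d (axis j 1, 0) (f \<circ> fst) y * (v $ j) * (v $ i))
                  + r\<^sup>2 * (X c x (v /\<^sub>R r) $ i)) *\<^sub>R ddu Q d i y)) \<and>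
        (\<forall>J \<gamma>. integral_curve (tangent_bundle Q) \<Gamma>' J \<gamma> \<longrightarrow>
           (let x = (\<lambda>i s. snd c (fst (\<gamma> s)) $ i) in
            \<forall>s\<in>J. fst (\<gamma> s) \<in> fst c \<longrightarrow> (let q = fst (\<gamma> s) in
              \<forall>i. (x i has_real_derivative deriv (x i) s) (at s) \<and>
                (deriv (x i) has_real_derivative
                  (\<Sum>j\<in>UNIV. 1 / f q * coord_deriv c (axis j 1) f q * deriv (x j) s) * deriv (x i) s
                  + (f q)\<^sup>2 * (X c (\<chi> j. x j s) (\<chi> j. 1 / f q * deriv (x j) s) $ i)) (at s))))"
    if c: "c \<in> charts Q" for c
    \<comment> \<open>The local expression expects a coordinate pair, whereas here x and v are the
      two projections of it; \<open>surjective_pairing\<close> supplies the pair.\<close>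
    unfolding Let_def
    by (intro conjI ballI allI impI scaled[OF c])
      (unfold \<Gamma>'_def,
        rule scaled_sode_local_expression[OF Q f c local_expr[OF c] _ surjective_pairing], assumption+,
        rule scaled_sode_second_order_equation[OF Q f c local_expr[OF c] _ _ _ refl refl], assumption+,
        rule scaled_sode_second_order_equation[OF Q f c local_expr[OF c] _ _ _ refl refl], assumption+)
  \<comment> \<open>Over q the natural structure sends the scaled field to f(q) times the Liouville
    field, which is nonzero at every nonzero tangent vector; this cannot equal the Liouville field
    if f(q) differs from 1.\<close>
  have not_sode: "\<not> is_sode Q (natural_structure Q) (natural_liouville Q) \<Gamma>'"
    if q: "q \<in> carrier Q" "f q \<noteq> 1" for q
  proof
    assume "is_sode Q (natural_structure Q) (natural_liouville Q) \<Gamma>'"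
    then have eq: "f (fst y) *\<^sub>R natural_liouville Q y = natural_liouville Q y"
      if "y \<in> carrier (tangent_bundle Q)" for y
      using natural_\<Gamma>'[OF that] that by (simp add: is_sode_def)
    obtain c where c: "c \<in> charts Q" "q \<in> fst c"
      using carrier_chartE[OF Q q(1)] by metis
    let ?e = "natural_chart Q c"
    \<comment> \<open>Any nonzero vector would do; \<open>undefined\<close> merely names some
      index.\<close>
    define a :: "real^'n" where "a = axis undefined 1"
    define y where "y = (q, coord_vec Q c a q)"
    have y: "y \<in> fst ?e" "snd (snd ?e y) = a"
      using coord_vec_in_tangent_space[OF Q c] comps_coord_vec_self[OF Q c] c by (simp_all add: y_def)
    note e = natural_chart_in_charts[OF Q c(1)]
    have "natural_liouville Q y = coord_vec (tangent_bundle Q) ?e (0, a) y"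
      using natural_liouville_eq[OF Q c(1) smooth_function_const _ y(1)] chart_liouville_eq[OF Q e y(1)] y(2)
      by simp
    then have "comps (natural_liouville Q y) ?e = (0, a)"
      by (simp add: comps_coord_vec_self[OF TQ e y(1)])
    then have "f q *\<^sub>R a = a"
      using arg_cong[OF eq[OF chartD(2)[OF TQ e y(1)]], of "\<lambda>v. comps v ?e"] by (simp add: y_def)
    from arg_cong[OF this, of "\<lambda>v. v $ undefined"] show False
      using q(2) by (simp add: a_def axis_def)
  qed
  have liouville_scaled: "natural_liouville Q y = chart_liouville Q (scaled_chart Q f c) y"
    if "c \<in> charts Q" "y \<in> fst (scaled_chart Q f c)" for c y
    by (rule natural_liouville_eq[OF Q that(1) f that(2)])
  have adapted: "scaled_chart Q f c \<in> adapted_charts Q S'" if c: "c \<in> charts Q" for c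
    unfolding adapted_charts_def
  proof (intro CollectI conjI ballI allI impI scaled[OF c] S'_scaled[OF c])
    show "fst (scaled_chart Q f c) =
        {y \<in> carrier (tangent_bundle Q). fst y \<in> fst ` fst (scaled_chart Q f c)}"
      using chartD(2)[OF TQ scaled[OF c]] by (auto simp: carrier_tangent_bundle[OF Q])
  qed simp_all
  have liouville: "is_liouville_of Q S' (natural_liouville Q)"
    unfolding is_liouville_of_def
  proof (intro conjI ballI vector_field_natural_liouville[OF Q])
    show "\<exists>d\<in>adapted_charts Q S'. y \<in> fst d" if "y \<in> carrier (tangent_bundle Q)" for y
      using scaled_cover[OF that] adapted by blast
    show "natural_liouville Q y = chart_liouville Q d y" if "d \<in> adapted_charts Q S'" "y \<in> fst d" for d y
      by (rule chart_liouville_adapted[OF Q f S'_scaled that])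
  qed
  have "is_sode Q S' (natural_liouville Q) \<Gamma>'"
    using \<Gamma>'_field S'_\<Gamma>' by (simp add: is_sode_def)
  moreover have "almost_tangent_structure (tangent_bundle Q) S'"
    by (rule constant_coeff_almost_tangent[OF TQ J(1) S'_const J(2)])
  moreover have "integrable_structure (tangent_bundle Q) S'"
    by (rule constant_coeff_integrable[OF TQ J(1) S'_const J(3)])
  ultimately show ?thesis
    by - (intro conjI, intro allI impI, elim conjE, rule part1, assumption, assumption,
        intro ballI, rule part2, assumption, intro impI, elim bexE, rule not_sode, assumption, assumption,
        assumption, assumption, intro ballI conjI, rule S'_scaled, assumption, assumption, assumption,
        rule liouville_scaled, assumption, assumption, rule liouville, assumption)
qed

end
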